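(* The icosian double $\mathbb{G}=\mathbb{I}\oplus\mathbb{I}\ell$ is a free $\mathbb{Z}[\varphi]$-order of rank $8$ in $\mathbb{O}(K)$. Moreover, the finite set $$S_{\mathbb{G}}=S_{H_4}\cup S_{H_4}\ell=\{a: a\in S_{H_4}\}\cup\{b\ell: b\in S_{H_4}\}\subset\mathbb{G}$$ has $240$ elements, is closed under negation and under the reflections $r_\alpha$, $\alpha\in S_{\mathbb{G}}$, has Cartan coefficients $\frac{2\langle\beta,\alpha\rangle}{\langle\alpha,\alpha\rangle}\in\mathbb{Z}[\varphi]$ for all $\alpha,\beta\in S_{\mathbb{G}}$, and realizes the non-crystallographic root system $H_4\oplus H_4$ (the orthogonal union of two root systems of type $H_4$).
   Context: Let $\varphi=(1+\sqrt5)/2$, $K=\mathbb{Q}(\sqrt5)\subset\mathbb{R}$. $\mathbb{H}(K)$ is the quaternion algebra over $K$ with basis $1,i,j,k$, $i^2=j^2=k^2=ijk=-1$, standard conjugation, and norm $N_{\mathbb{H}}(a)=a\overline{a}$. The icosian ring $\mathbb{I}\subset\mathbb{H}(K)$ is the free $\mathbb{Z}[\varphi]$-module with basis $$e_1=1,\quad e_2=i,\quad e_3=\tfrac12(1+i+j+k),\quad e_4=\tfrac12(-1+(\varphi-1)i-\varphi j).$$ $S_{H_4}\subset\mathbb{I}$ is the set of $120$ norm-one quaternions $a+bi+cj+dk$ whose coordinate vector $(a,b,c,d)$ is one of: all permutations of $(\pm1,0,0,0)$; $\frac12(\pm1,\pm1,\pm1,\pm1)$ with all signs; all even permutations of $\frac12(0,\pm1,\pm\varphi,\pm\varphi^{-1})$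 with all signs. With the form $\mathrm{Re}(x\overline{y})$ this is the standard root system of type $H_4$. $\mathbb{O}(K)=\mathbb{H}(K)\oplus\mathbb{H}(K)\ell$ is the Cayley--Dickson double with product $(a+b\ell)(c+d\ell)=(ac-\overline{d}b)+(da+b\overline{c})\ell$ (so $\ell^2=-1$, $\ell a=\overline{a}\ell$), conjugation $\overline{a+b\ell}=\overline{a}-b\ell$, norm $N(x)=x\overline{x}$, trace $\mathrm{Tr}(x)=x+\overline{x}$. The inner product is $\langle x,y\rangle=\mathrm{Re}(x\overline{y})$, extended to the Euclidean space $\mathbb{O}(K)\otimes_K\mathbb{R}$, and $r_\alpha(v)=v-\frac{2\langle v,\alpha\rangle}{\langle\alpha,\alpha\rangle}\alpha$. A $\mathbb{Z}[\varphi]$-order in $\mathbb{O}(K)$ is a subset that is a finitely generated $\mathbb{Z}[\varphi]$-module, contains $1$, is closed under addition, multiplication and conjugation, and on which the trace and the norm take values in $\mathbb{Z}[\varphi]$. *)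

theory Defs
  imports "HOL-Analysis.Analysis" "HOL-Combinatorics.Permutations"
begin

definition phi :: real where
  "phi = (1 + sqrt 5) / 2"

definition K5 :: "real set" where
  "K5 = {a + b * sqrt 5 | a b. a \<in> \<rat> \<and> b \<in> \<rat>}"

text \<open>The ring \<open>\<int>[\<phi>]\<close>; since \<open>\<phi>\<^sup>2 = \<phi> + 1\<close>, it is \<open>\<int> + \<int>\<phi>\<close>.\<close>

definition Zphi :: "real set" where
  "Zphi = {a + b * phi | a b. a \<in> \<int> \<and> b \<in> \<int>}"

text \<open>Only meant for finite \<open>B\<close>: the \<open>\<int>[\<phi>]\<close>-submodule generated by \<open>B\<close>.\<close>

definition Zphi_span :: "'a::real_vector set \<Rightarrow> 'a set" where
  "Zphi_span B = {(\<Sum>b\<in>B. c b *\<^sub>R b) | c. \<forall>b\<in>B. c b \<in> Zphi}"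

definition Zphi_independent :: "'a::real_vector set \<Rightarrow> bool" where
  "Zphi_independent B \<longleftrightarrow>
     (\<forall>c. (\<forall>b\<in>B. c b \<in> Zphi) \<and> (\<Sum>b\<in>B. c b *\<^sub>R b) = 0 \<longrightarrow> (\<forall>b\<in>B. c b = 0))"

definition Zphi_finitely_generated :: "'a::real_vector set \<Rightarrow> bool" where
  "Zphi_finitely_generated A \<longleftrightarrow> (\<exists>B. finite B \<and> A = Zphi_span B)"

definition Zphi_free_of_rank :: "nat \<Rightarrow> 'a::real_vector set \<Rightarrow> bool" where
  "Zphi_free_of_rank n A \<longleftrightarrow>
     (\<exists>B. finite B \<and> card B = n \<and> Zphi_independent B \<and> A = Zphi_span B)"

text \<open>
  All algebras over \<open>K = \<rat>(\<surd>5) \<subseteq> \<real>\<close> are realised as subsets of the corresponding real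
  algebras, which play the role of the extensions of scalars from \<open>K\<close> to \<open>\<real>\<close>.
\<close>

datatype quat = Quat (q1: real) (qi: real) (qj: real) (qk: real)

instantiation quat :: real_algebra_1
begin

definition "0 = Quat 0 0 0 0"
definition "1 = Quat 1 0 0 0"
definition "x + y = Quat (q1 x + q1 y) (qi x + qi y) (qj x + qj y) (qk x + qk y)"
definition "- x = Quat (- q1 x) (- qi x) (- qj x) (- qk x)"
definition "x - y = Quat (q1 x - q1 y) (qi x - qi y) (qj x - qj y) (qk x - qk y)"
definition "r *\<^sub>R x = Quat (r * q1 x) (r * qi x) (r * qj x) (r * qk x)"
definition "x * y = Quat
  (q1 x * q1 y - qi x * qi y - qj x * qj y - qk x * qk y)
  (q1 x * qi y + qi x * q1 y + qj x * qk y - qk x * qj y)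
  (q1 x * qj y - qi x * qk y + qj x * q1 y + qk x * qi y)
  (q1 x * qk y + qi x * qj y - qj x * qi y + qk x * q1 y)"

lemmas quat_defs = zero_quat_def one_quat_def plus_quat_def uminus_quat_def
  minus_quat_def scaleR_quat_def times_quat_def

instance
  by standard (simp_all add: quat_defs algebra_simps)

end

definition quat_i :: quat where "quat_i = Quat 0 1 0 0"
definition quat_j :: quat where "quat_j = Quat 0 0 1 0"
definition quat_k :: quat where "quat_k = Quat 0 0 0 1"

lemma quat_relations:
  "quat_i * quat_i = -1" "quat_j * quat_j = -1" "quat_k * quat_k = -1"
  "quat_i * quat_j * quat_k = -1"
  by (simp_all add: quat_i_def quat_j_def quat_k_def quat_defs)

definition qcnj :: "quat \<Rightarrow> quat" where
  "qcnj x = Quat (q1 x) (- qi x) (- qj x) (- qk x)"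

definition quats_K :: "quat set" where
  "quats_K = {x. q1 x \<in> K5 \<and> qi x \<in> K5 \<and> qj x \<in> K5 \<and> qk x \<in> K5}"

definition icosians :: "quat set" where
  "icosians = Zphi_span
     {1, quat_i,
      (1/2) *\<^sub>R (1 + quat_i + quat_j + quat_k),
      (1/2) *\<^sub>R (- 1 + (phi - 1) *\<^sub>R quat_i - phi *\<^sub>R quat_j)}"

definition qcoords :: "quat \<Rightarrow> real list" where
  "qcoords x = [q1 x, qi x, qj x, qk x]"

text \<open>
  \<^const>\<open>permute_list\<close> \<open>\<sigma> xs\<close> has entries \<open>xs ! \<sigma> i\<close>; as \<open>\<sigma>\<close> ranges over all (or all even)
  permutations of the four positions, this runs through all (even) rearrangements.
\<close>

definition S_H4 :: "quat set" where
  "S_H4 =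
     {x. \<exists>\<sigma> s. \<sigma> permutes {..<4} \<and> s \<in> {1, -1} \<and>
           qcoords x = permute_list \<sigma> [s, 0, 0, 0]} \<union>
     {x. \<exists>s\<^sub>1\<in>{1, -1}. \<exists>s\<^sub>2\<in>{1, -1}. \<exists>s\<^sub>3\<in>{1, -1}. \<exists>s\<^sub>4\<in>{1, -1}.
           x = (1/2) *\<^sub>R Quat s\<^sub>1 s\<^sub>2 s\<^sub>3 s\<^sub>4} \<union>
     {x. \<exists>\<sigma>. \<sigma> permutes {..<4} \<and> evenperm \<sigma> \<and>
           (\<exists>s\<^sub>1\<in>{1, -1}. \<exists>s\<^sub>2\<in>{1, -1}. \<exists>s\<^sub>3\<in>{1, -1}.
              qcoords x = permute_list \<sigma> [0, s\<^sub>1 / 2, s\<^sub>2 * phi / 2, s\<^sub>3 * inverse phi / 2])}"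

text \<open>The element \<open>a + b\<ell>\<close> of the Cayley--Dickson double is \<open>Oct a b\<close>.\<close>

datatype octonion = Oct (hpart: quat) (lpart: quat)

definition ocnj :: "octonion \<Rightarrow> octonion" where
  "ocnj x = Oct (qcnj (hpart x)) (- lpart x)"

definition ore :: "octonion \<Rightarrow> real" where
  "ore x = q1 (hpart x)"

instantiation octonion :: "{times, one, euclidean_space}"
begin

definition "0 = Oct 0 0"
definition "1 = Oct 1 0"
definition "x + y = Oct (hpart x + hpart y) (lpart x + lpart y)"
definition "- x = Oct (- hpart x) (- lpart x)"
definition "x - y = Oct (hpart x - hpart y) (lpart x - lpart y)"
definition "r *\<^sub>R x = Oct (r *\<^sub>R hpart x) (r *\<^sub>R lpart x)"
definition "x * y = Oct
  (hpart x * hpart y - qcnj (lpart y) * lpart x)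
  (lpart y * hpart x + lpart x * qcnj (hpart y))"
definition inner_octonion :: "octonion \<Rightarrow> octonion \<Rightarrow> real"
  where "inner_octonion x y = ore (x * ocnj y)"
definition norm_octonion :: "octonion \<Rightarrow> real"
  where "norm_octonion x = sqrt (inner x x)"
definition sgn_octonion :: "octonion \<Rightarrow> octonion"
  where "sgn_octonion x = inverse (norm x) *\<^sub>R x"
definition dist_octonion :: "octonion \<Rightarrow> octonion \<Rightarrow> real"
  where "dist_octonion x y = norm (x - y)"
definition uniformity_octonion :: "(octonion \<times> octonion) filter"
  where "uniformity_octonion = (INF e\<in>{0<..}. principal {(x, y). dist x y < e})"
definition open_octonion :: "octonion set \<Rightarrow> bool"
  where "open_octonion U \<longleftrightarrow> (\<forall>x\<in>U. \<forall>\<^sub>F (x', y) in uniformity. x' = x \<longrightarrow> y \<in> U)"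
definition Basis_octonion :: "octonion set"
  where "Basis_octonion =
    (\<lambda>q. Oct q 0) ` {1, quat_i, quat_j, quat_k} \<union> Oct 0 ` {1, quat_i, quat_j, quat_k}"

lemmas octonion_defs = zero_octonion_def one_octonion_def plus_octonion_def
  uminus_octonion_def minus_octonion_def scaleR_octonion_def times_octonion_def

lemma inner_octonion_coords:
  fixes x y :: octonion
  shows "inner x y =
    q1 (hpart x) * q1 (hpart y) + qi (hpart x) * qi (hpart y) +
    qj (hpart x) * qj (hpart y) + qk (hpart x) * qk (hpart y) +
    q1 (lpart x) * q1 (lpart y) + qi (lpart x) * qi (lpart y) +
    qj (lpart x) * qj (lpart y) + qk (lpart x) * qk (lpart y)"
  by (simp add: inner_octonion_def ore_def ocnj_def qcnj_def octonion_defs quat_defs)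

lemma octonion_eq_iff:
  "x = y \<longleftrightarrow>
    q1 (hpart x) = q1 (hpart y) \<and> qi (hpart x) = qi (hpart y) \<and>
    qj (hpart x) = qj (hpart y) \<and> qk (hpart x) = qk (hpart y) \<and>
    q1 (lpart x) = q1 (lpart y) \<and> qi (lpart x) = qi (lpart y) \<and>
    qj (lpart x) = qj (lpart y) \<and> qk (lpart x) = qk (lpart y)"
  by (auto intro: octonion.expand quat.expand)

lemma Basis_octonion_cases:
  assumes "x \<in> Basis"
  obtains "x = Oct 1 0" | "x = Oct quat_i 0" | "x = Oct quat_j 0" | "x = Oct quat_k 0"
    | "x = Oct 0 1" | "x = Oct 0 quat_i" | "x = Oct 0 quat_j" | "x = Oct 0 quat_k"
  using assms unfolding Basis_octonion_def by blast

instance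
proof
  fix x y z :: octonion and r s :: real
  show "x + y + z = x + (y + z)" "x + y = y + x" "0 + x = x" "- x + x = 0" "x - y = x + - y"
    "r *\<^sub>R (x + y) = r *\<^sub>R x + r *\<^sub>R y" "(r + s) *\<^sub>R x = r *\<^sub>R x + s *\<^sub>R x"
    "r *\<^sub>R s *\<^sub>R x = (r * s) *\<^sub>R x" "1 *\<^sub>R x = x"
    by (simp_all add: octonion_defs scaleR_add_left scaleR_add_right)
  show "dist x y = norm (x - y)" by (rule dist_octonion_def)
  show "sgn x = inverse (norm x) *\<^sub>R x" by (rule sgn_octonion_def)
  show "norm x = sqrt (inner x x)" by (rule norm_octonion_def)
  show "inner x y = inner y x" by (simp add: inner_octonion_coords mult.commute)
  show "inner (x + y) z = inner x z + inner y z"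
    by (simp add: inner_octonion_coords plus_octonion_def plus_quat_def distrib_right)
  show "inner (r *\<^sub>R x) y = r * inner x y"
    by (simp add: inner_octonion_coords scaleR_octonion_def scaleR_quat_def distrib_left mult.assoc)
  show "0 \<le> inner x x"
    unfolding inner_octonion_coords by (intro add_nonneg_nonneg zero_le_square)
  have sum8: "a*a + b*b + c*c + d*d + e*e + f*f + g*g + h*h = 0 \<longleftrightarrow>
      a = 0 \<and> b = 0 \<and> c = 0 \<and> d = 0 \<and> e = 0 \<and> f = 0 \<and> g = 0 \<and> h = 0"
    for a b c d e f g h :: real
    by (simp add: add_nonneg_eq_0_iff)
  show "inner x x = 0 \<longleftrightarrow> x = 0"
    unfolding inner_octonion_coords sum8 zero_octonion_def zero_quat_def
    by (simp add: octonion_eq_iff conj_ac)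
  show "(uniformity :: (octonion \<times> octonion) filter) =
      (INF e\<in>{0<..}. principal {(x, y). dist x y < e})"
    by (rule uniformity_octonion_def)
  show "open U \<longleftrightarrow> (\<forall>x\<in>U. \<forall>\<^sub>F (x', y) in uniformity. x' = x \<longrightarrow> y \<in> U)" for U :: "octonion set"
    by (rule open_octonion_def)
  show "(Basis :: octonion set) \<noteq> {}" "finite (Basis :: octonion set)"
    by (simp_all add: Basis_octonion_def)
  show "inner x y = (if x = y then 1 else 0)" if "x \<in> Basis" "y \<in> Basis"
    using that
    by (elim Basis_octonion_cases)
       (simp_all add: inner_octonion_coords quat_i_def quat_j_def quat_k_def zero_quat_def one_quat_def)
  show "(\<forall>y\<in>Basis. inner x y = 0) \<longleftrightarrow> x = 0"
    unfolding octonion_eq_iff[of x 0]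
    by (simp add: Basis_octonion_def inner_octonion_coords conj_ac ball_Un
          quat_i_def quat_j_def quat_k_def zero_quat_def one_quat_def zero_octonion_def)
qed

end

lemma Oct_eq: "Oct a b = Oct a 0 + Oct b 0 * Oct 0 1"
  by (simp add: octonion_defs qcnj_def quat_defs)

definition octonions_K :: "octonion set" where
  "octonions_K = {Oct a b | a b. a \<in> quats_K \<and> b \<in> quats_K}"

text \<open>The trace and the norm are scalar octonions; scalars are the real multiples of \<open>1\<close>.\<close>

definition otrace :: "octonion \<Rightarrow> octonion" where
  "otrace x = x + ocnj x"

definition onorm2 :: "octonion \<Rightarrow> octonion" where
  "onorm2 x = x * ocnj x"

definition Zphi_scalars :: "octonion set" where
  "Zphi_scalars = {c *\<^sub>R 1 | c. c \<in> Zphi}"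

definition Zphi_order :: "octonion set \<Rightarrow> bool" where
  "Zphi_order A \<longleftrightarrow>
     A \<subseteq> octonions_K \<and>
     Zphi_finitely_generated A \<and>
     1 \<in> A \<and>
     (\<forall>x\<in>A. \<forall>y\<in>A. x + y \<in> A) \<and>
     (\<forall>x\<in>A. \<forall>y\<in>A. x * y \<in> A) \<and>
     (\<forall>x\<in>A. ocnj x \<in> A) \<and>
     (\<forall>x\<in>A. otrace x \<in> Zphi_scalars) \<and>
     (\<forall>x\<in>A. onorm2 x \<in> Zphi_scalars)"

definition icosian_double :: "octonion set" where
  "icosian_double = {Oct a b | a b. a \<in> icosians \<and> b \<in> icosians}"

definition S_left :: "octonion set" where
  "S_left = {Oct a 0 | a. a \<in> S_H4}"

definition S_right :: "octonion set" where
  "S_right = {Oct 0 b | b. b \<in> S_H4}"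

definition S_G :: "octonion set" where
  "S_G = S_left \<union> S_right"

definition cartan :: "'a::real_inner \<Rightarrow> 'a \<Rightarrow> real" where
  "cartan \<beta> \<alpha> = 2 * inner \<beta> \<alpha> / inner \<alpha> \<alpha>"

definition refl_root :: "'a::real_inner \<Rightarrow> 'a \<Rightarrow> 'a" where
  "refl_root \<alpha> v = v - cartan v \<alpha> *\<^sub>R \<alpha>"

text \<open>Reduced root systems spanning the subspace \<open>V\<close>; no integrality is required.\<close>

definition root_system :: "'a::real_inner set \<Rightarrow> 'a set \<Rightarrow> bool" where
  "root_system V \<Phi> \<longleftrightarrow>
     finite \<Phi> \<and> 0 \<notin> \<Phi> \<and> span \<Phi> = V \<and>
     (\<forall>\<alpha>\<in>\<Phi>. \<Phi> \<inter> span {\<alpha>} = {\<alpha>, - \<alpha>}) \<and>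
     (\<forall>\<alpha>\<in>\<Phi>. refl_root \<alpha> ` \<Phi> = \<Phi>)"

definition crystallographic :: "'a::real_inner set \<Rightarrow> bool" where
  "crystallographic \<Phi> \<longleftrightarrow> (\<forall>\<alpha>\<in>\<Phi>. \<forall>\<beta>\<in>\<Phi>. cartan \<beta> \<alpha> \<in> \<int>)"

definition simple_system :: "'a::real_inner set \<Rightarrow> 'a set \<Rightarrow> bool" where
  "simple_system \<Phi> \<Delta> \<longleftrightarrow>
     finite \<Delta> \<and> \<Delta> \<subseteq> \<Phi> \<and> independent \<Delta> \<and>
     (\<forall>\<beta>\<in>\<Phi>. \<exists>c. \<beta> = (\<Sum>\<alpha>\<in>\<Delta>. c \<alpha> *\<^sub>R \<alpha>) \<and>
        ((\<forall>\<alpha>\<in>\<Delta>. 0 \<le> c \<alpha>) \<or> (\<forall>\<alpha>\<in>\<Delta>. c \<alpha> \<le> 0)))"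

text \<open>
  A root system has Coxeter matrix \<open>m\<close> of rank \<open>n\<close> if it has a simple system
  \<open>a\<^sub>0, \<dots>, a\<^sub>n\<^sub>-\<^sub>1\<close> in which the angle between \<open>a\<^sub>i\<close> and \<open>a\<^sub>j\<close> is \<open>\<pi> - \<pi> / m\<^sub>i\<^sub>j\<close>.
\<close>

definition has_coxeter_matrix :: "nat \<Rightarrow> (nat \<Rightarrow> nat \<Rightarrow> nat) \<Rightarrow> 'a::real_inner set \<Rightarrow> bool" where
  "has_coxeter_matrix n m \<Phi> \<longleftrightarrow>
     (\<exists>a. inj_on a {..<n} \<and> simple_system \<Phi> (a ` {..<n}) \<and>
        (\<forall>i<n. \<forall>j<n.
           inner (a i) (a j) = norm (a i) * norm (a j) * cos (pi - pi / real (m i j))))"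

text \<open>The linear Coxeter diagram with edge labels 5, 3, 3.\<close>

definition coxeter_H4 :: "nat \<Rightarrow> nat \<Rightarrow> nat" where
  "coxeter_H4 i j =
     (if i = j then 1
      else if {i, j} = {0, 1} then 5
      else if {i, j} = {1, 2} \<or> {i, j} = {2, 3} then 3
      else 2)"

definition root_system_H4 :: "'a::real_inner set \<Rightarrow> 'a set \<Rightarrow> bool" where
  "root_system_H4 V \<Phi> \<longleftrightarrow> root_system V \<Phi> \<and> has_coxeter_matrix 4 coxeter_H4 \<Phi>"

definition orthogonal_union :: "'a::real_inner set \<Rightarrow> 'a set \<Rightarrow> 'a set \<Rightarrow> bool" where
  "orthogonal_union \<Phi> \<Phi>\<^sub>1 \<Phi>\<^sub>2 \<longleftrightarrow>
     \<Phi> = \<Phi>\<^sub>1 \<union> \<Phi>\<^sub>2 \<and> (\<forall>\<alpha>\<in>\<Phi>\<^sub>1. \<forall>\<beta>\<in>\<Phi>\<^sub>2. orthogonal \<alpha> \<beta>)"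

end

theory Submission
  imports Defs
begin

text \<open>
  The 120 roots form a multiplicative group: they are the monoid generated by the basis icosians
  \<open>i, e\<^sub>3, e\<^sub>4\<close>. It suffices to check that left multiplication by these three elements permutes the
  roots, and that every root has the form \<open>(e\<^sub>4 i)\<^sup>k e\<^sub>3\<^sup>l (e\<^sub>3 i e\<^sub>3\<^sup>2)\<^sup>m i\<^sup>n\<close>; both are computations with doubled
  coordinates in \<open>\<int> + \<int>\<phi>\<close>. Hence the roots are icosians of norm one, and the reflection in a root \<open>a\<close> is
  \<open>b \<mapsto> - a (cnj b) a\<close>, which preserves the group. Since \<open>2\<langle>b, a\<rangle>\<close> is the trace of the icosian
  \<open>b (cnj a)\<close>, all Cartan coefficients lie in \<open>\<int>[\<phi>]\<close>. Trace and norm of an icosian are scalar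
  icosians, and the scalar icosians are \<open>\<int>[\<phi>]\<close>.
\<close>

subsection \<open>The ring of icosians\<close>

lemma phi_squared: "phi * phi = phi + 1"
proof -
  have "sqrt 5 * sqrt 5 = (5::real)" by simp
  then show ?thesis unfolding phi_def by (simp add: field_simps)
qed

lemma phi_mult_assoc: "phi * (phi * x) = phi * x + x"
  using arg_cong[OF phi_squared, of "\<lambda>y. y * x"] by (simp add: distrib_right mult.assoc)

lemmas phi_simps = phi_squared phi_mult_assoc

lemma phi_bounds: "1 < phi" "phi < 2"
proof -
  have "sqrt 1 < sqrt (5::real)" "sqrt (5::real) < sqrt 9" by (simp_all only: real_sqrt_less_iff)
  moreover have "sqrt 9 = (3::real)" by (rule real_sqrt_unique) simp_all
  ultimately show "1 < phi" "phi < 2" unfolding phi_def by simp_all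
qed

lemma inverse_phi: "inverse phi = phi - 1"
proof -
  have "phi * (phi - 1) = 1" by (simp add: phi_squared right_diff_distrib)
  then show ?thesis by (rule inverse_unique)
qed

lemma Zphi_of_int: "of_int a + of_int b * phi \<in> Zphi"
  unfolding Zphi_def using Ints_of_int by blast

lemma Zphi_Ints: "a \<in> \<int> \<Longrightarrow> a \<in> Zphi"
  unfolding Zphi_def by force

lemma Zphi_phi [simp]: "phi \<in> Zphi"
  using Zphi_of_int[of 0 1] by simp

lemma Zphi_simple [simp]: "0 \<in> Zphi" "1 \<in> Zphi" "numeral n \<in> Zphi" "of_int k \<in> Zphi"
  by (simp_all add: Zphi_Ints)

lemma Zphi_E:
  assumes "x \<in> Zphi"
  obtains a b :: int where "x = of_int a + of_int b * phi"
  using assms unfolding Zphi_def by (auto elim!: Ints_cases)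

lemma Zphi_add [intro]: "x + y \<in> Zphi" if "x \<in> Zphi" "y \<in> Zphi"
proof -
  from that obtain a b c d :: int where
    "x = of_int a + of_int b * phi" "y = of_int c + of_int d * phi" by (meson Zphi_E)
  then have "x + y = of_int (a + c) + of_int (b + d) * phi" by (simp add: algebra_simps)
  then show ?thesis by (metis Zphi_of_int)
qed

lemma Zphi_mult [intro]: "x * y \<in> Zphi" if "x \<in> Zphi" "y \<in> Zphi"
proof -
  from that obtain a b c d :: int where
    "x = of_int a + of_int b * phi" "y = of_int c + of_int d * phi" by (meson Zphi_E)
  then have "x * y = of_int (a * c + b * d) + of_int (a * d + b * c + b * d) * phi"
    by (simp add: algebra_simps phi_simps)
  then show ?thesis by (metis Zphi_of_int)
qed

lemma Zphi_uminus [simp]: "- x \<in> Zphi \<longleftrightarrow> x \<in> Zphi"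
  using Zphi_mult[OF Zphi_of_int[of "- 1" 0], of x] Zphi_mult[OF Zphi_of_int[of "- 1" 0], of "- x"]
  by auto

lemma Zphi_diff [intro]: "x - y \<in> Zphi" if "x \<in> Zphi" "y \<in> Zphi"
  using Zphi_add[of x "- y"] that by simp

lemma Zphi_subset_K5: "Zphi \<subseteq> K5"
proof
  fix x assume "x \<in> Zphi"
  then obtain a b :: int where x: "x = of_int a + of_int b * phi" by (rule Zphi_E)
  then have "x = (of_int a + of_int b / 2) + (of_int b / 2) * sqrt 5"
    unfolding phi_def by (simp add: field_simps)
  moreover have "of_int a + of_int b / 2 \<in> (\<rat>::real set)" "of_int b / 2 \<in> (\<rat>::real set)"
    by (intro Rats_add Rats_divide Rats_of_int Rats_number_of)+
  ultimately show "x \<in> K5" unfolding K5_def by blast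
qed

lemma K5_half: "x / 2 \<in> K5" if "x \<in> K5"
proof -
  from that obtain a b where "a \<in> \<rat>" "b \<in> \<rat>" "x = a + b * sqrt 5" unfolding K5_def by auto
  then have "x / 2 = a / 2 + b / 2 * sqrt 5" "a / 2 \<in> \<rat>" "b / 2 \<in> \<rat>" by (auto simp: field_simps)
  then show ?thesis unfolding K5_def by blast
qed

lemma sqrt_5_irrational: "sqrt 5 \<notin> \<rat>"
proof
  assume "sqrt 5 \<in> \<rat>"
  then obtain m n :: nat where "n \<noteq> 0" "\<bar>sqrt 5\<bar> = m / n" and cop: "coprime m n"
    by (rule Rats_abs_nat_div_natE)
  then have "sqrt 5 * real n = real m" by (simp add: field_simps)
  then have "(sqrt 5 * real n)\<^sup>2 = (real m)\<^sup>2" by simp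
  then have "5 * (real n)\<^sup>2 = (real m)\<^sup>2" by (simp add: power_mult_distrib)
  then have "real (5 * n\<^sup>2) = real (m\<^sup>2)" by simp
  then have eq: "5 * n\<^sup>2 = m\<^sup>2" by (simp only: of_nat_eq_iff)
  \<comment> \<open>The rule \<open>prime_nat_iff'\<close> reduces primality of 5 to trial division
    by these numbers.\<close>
  have "{2..<5::nat} = {2, 3, 4}" by auto
  then have prime5: "prime (5::nat)" by (simp add: prime_nat_iff')
  have "5 dvd m\<^sup>2" by (simp flip: eq)
  with prime5 have "5 dvd m" by (rule prime_dvd_power)
  then obtain k where "m = 5 * k" by (rule dvdE)
  then have "n\<^sup>2 = 5 * k\<^sup>2" using eq by (simp add: power2_eq_square)
  then have "5 dvd n\<^sup>2" by simp
  with prime5 have "5 dvd n" by (rule prime_dvd_power)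
  with cop \<open>5 dvd m\<close> have "is_unit (5::nat)" by (rule coprime_common_divisor)
  then show False by simp
qed

text \<open>Two representations would make \<open>phi\<close>, and with it \<open>sqrt 5\<close>,
  rational. This uniqueness makes integer coordinates faithful, on which the count of 120 roots
  relies.\<close>

lemma phi_independent:
  fixes a b c d :: int
  assumes "of_int a + of_int b * phi = of_int c + of_int d * phi"
  shows "a = c \<and> b = d"
proof -
  have eq: "of_int (b - d) * phi = of_int (c - a)" using assms by (simp add: algebra_simps)
  have "b = d"
  proof (rule ccontr)
    assume "b \<noteq> d"
    then have "of_int (b - d) \<noteq> (0::real)" by simp
    then have "phi = of_int (b - d) * phi / of_int (b - d)" by (simp del: of_int_diff)
    also have "\<dots> = of_int (c - a) / of_int (b - d)" unfolding eq ..
    also have "\<dots> \<in> \<rat>" by (intro Rats_divide Rats_of_int)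
    finally have "phi \<in> \<rat>" .
    moreover have "sqrt 5 = 2 * phi - 1" unfolding phi_def by (simp add: field_simps)
    ultimately show False using sqrt_5_irrational by simp
  qed
  with assms show ?thesis by auto
qed

section \<open>Modules spanned over Z[phi]\<close>

lemma Zphi_span_memI: "(\<And>b. b \<in> B \<Longrightarrow> c b \<in> Zphi) \<Longrightarrow> (\<Sum>b\<in>B. c b *\<^sub>R b) \<in> Zphi_span B"
  unfolding Zphi_span_def by blast

lemma Zphi_span_0: "0 \<in> Zphi_span B"
  using Zphi_span_memI[of B "\<lambda>_. 0"] by simp

lemma Zphi_span_base: "x \<in> Zphi_span B" if "finite B" "x \<in> B"
proof -
  have "(\<Sum>b\<in>B. (if b = x then 1 else 0) *\<^sub>R b) = (\<Sum>b\<in>B. if b = x then b else 0)"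
    by (rule sum.cong) auto
  also have "\<dots> = x" using that by simp
  finally show ?thesis using Zphi_span_memI[of B "\<lambda>b. if b = x then 1 else 0"] by simp
qed

lemma Zphi_span_add: "x + y \<in> Zphi_span B" if "x \<in> Zphi_span B" "y \<in> Zphi_span B"
proof -
  from that obtain c d where "\<forall>b\<in>B. c b \<in> Zphi" "\<forall>b\<in>B. d b \<in> Zphi"
    "x = (\<Sum>b\<in>B. c b *\<^sub>R b)" "y = (\<Sum>b\<in>B. d b *\<^sub>R b)" unfolding Zphi_span_def by blast
  then show ?thesis using Zphi_span_memI[of B "\<lambda>b. c b + d b"]
    by (auto simp: scaleR_add_left sum.distrib)
qed

lemma Zphi_span_scale: "r *\<^sub>R x \<in> Zphi_span B" if "r \<in> Zphi" "x \<in> Zphi_span B"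
proof -
  from that obtain c where "\<forall>b\<in>B. c b \<in> Zphi" "x = (\<Sum>b\<in>B. c b *\<^sub>R b)"
    unfolding Zphi_span_def by blast
  then show ?thesis using that(1) Zphi_span_memI[of B "\<lambda>b. r * c b"]
    by (auto simp: scaleR_sum_right)
qed

lemma Zphi_span_uminus: "- x \<in> Zphi_span B" if "x \<in> Zphi_span B"
  using Zphi_span_scale[of "- 1" x B] that by simp

lemma Zphi_span_diff: "x - y \<in> Zphi_span B" if "x \<in> Zphi_span B" "y \<in> Zphi_span B"
  using Zphi_span_add[OF that(1) Zphi_span_uminus[OF that(2)]] by simp

lemma Zphi_span_sum: "(\<And>i. i \<in> I \<Longrightarrow> f i \<in> Zphi_span B) \<Longrightarrow> sum f I \<in> Zphi_span B"
  by (induction I rule: infinite_finite_induct) (auto intro: Zphi_span_0 Zphi_span_add)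

lemma Zphi_span_linear_image:
  assumes "linear f" "\<And>b. b \<in> B \<Longrightarrow> f b \<in> Zphi_span C" "x \<in> Zphi_span B"
  shows "f x \<in> Zphi_span C"
proof -
  obtain c where c: "\<forall>b\<in>B. c b \<in> Zphi" "x = (\<Sum>b\<in>B. c b *\<^sub>R b)"
    using assms(3) unfolding Zphi_span_def by blast
  then have "f x = (\<Sum>b\<in>B. c b *\<^sub>R f b)"
    using assms(1) by (simp add: linear_sum linear_scale)
  then show ?thesis using c(1) assms(2) by (auto intro!: Zphi_span_sum Zphi_span_scale)
qed

text \<open>The product is linear in each factor, so the claim reduces to generators first on the
  right, then on the left.\<close>

lemma Zphi_span_mult:
  fixes B :: "'a::real_algebra set"
  assumes "\<And>b c. b \<in> B \<Longrightarrow> c \<in> B \<Longrightarrow> b * c \<in> Zphi_span B"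
    and "x \<in> Zphi_span B" "y \<in> Zphi_span B"
  shows "x * y \<in> Zphi_span B"
proof -
  have lin: "linear (\<lambda>x. x * z)" "linear (\<lambda>x. z * x)" for z :: 'a
    by (auto intro!: linearI simp: algebra_simps)
  have "b * y \<in> Zphi_span B" if "b \<in> B" for b
    using Zphi_span_linear_image[OF lin(2)[of b]] assms that by blast
  then show ?thesis using Zphi_span_linear_image[OF lin(1)[of y]] assms(2) by blast
qed

section \<open>Conjugation, trace and norm of quaternions\<close>

lemmas Quat_simps = quat_defs quat_i_def quat_j_def quat_k_def qcnj_def

lemma qcnj_mult: "qcnj (x * y) = qcnj y * qcnj x"
  by (simp add: Quat_simps)

lemma qcnj_qcnj [simp]: "qcnj (qcnj x) = x"
  by (simp add: Quat_simps)

lemma qcnj_simps [simp]: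
  "qcnj 0 = 0" "qcnj 1 = 1" "qcnj (- x) = - qcnj x" "qcnj (x + y) = qcnj x + qcnj y"
  by (simp_all add: Quat_simps)

lemma linear_qcnj: "linear qcnj"
  by (rule linearI) (simp_all add: Quat_simps)

lemma qcnj_trace: "x + qcnj x = (2 * q1 x) *\<^sub>R 1"
  by (simp add: Quat_simps)

lemma q1_linear [simp]: 
  "q1 0 = 0" "q1 1 = 1" "q1 (x + y) = q1 x + q1 y" "q1 (x - y) = q1 x - q1 y" "q1 (- x) = - q1 x"
  "q1 (r *\<^sub>R x) = r * q1 x"
  by (simp_all add: quat_defs)

definition qnorm2 :: "quat \<Rightarrow> real" where
  "qnorm2 x = (q1 x)\<^sup>2 + (qi x)\<^sup>2 + (qj x)\<^sup>2 + (qk x)\<^sup>2"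

lemma mult_qcnj: "x * qcnj x = qnorm2 x *\<^sub>R 1" and qcnj_mult_self: "qcnj x * x = qnorm2 x *\<^sub>R 1"
  by (simp_all add: Quat_simps qnorm2_def power2_eq_square)

lemma qnorm2_mult: "qnorm2 (x * y) = qnorm2 x * qnorm2 y"
  by (simp add: Quat_simps qnorm2_def power2_eq_square algebra_simps)

section \<open>The basis icosians and the closure of their span\<close>

definition ico3 :: quat where "ico3 = (1/2) *\<^sub>R (1 + quat_i + quat_j + quat_k)"
definition ico4 :: quat where
  "ico4 = (1/2) *\<^sub>R (- 1 + (phi - 1) *\<^sub>R quat_i - phi *\<^sub>R quat_j)"

lemmas ico_simps = ico3_def ico4_def Quat_simps

abbreviation ico_basis :: "quat set" where
  "ico_basis \<equiv> {1, quat_i, ico3, ico4}"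

lemma icosians_eq: "icosians = Zphi_span ico_basis"
  unfolding icosians_def ico3_def ico4_def ..

lemma ico_basis_distinct:
  "1 \<noteq> quat_i" "1 \<noteq> ico3" "1 \<noteq> ico4" "quat_i \<noteq> ico3" "quat_i \<noteq> ico4" "ico3 \<noteq> ico4"
  by (simp_all add: ico_simps)

lemma ico_basis_sum:
  "(\<Sum>b\<in>ico_basis. c b *\<^sub>R b)
    = c 1 *\<^sub>R 1 + c quat_i *\<^sub>R quat_i + c ico3 *\<^sub>R ico3 + c ico4 *\<^sub>R ico4"
  by (simp add: ico_basis_distinct)

lemma icosiansE:
  assumes "x \<in> icosians"
  obtains a b c d where "x = a *\<^sub>R 1 + b *\<^sub>R quat_i + c *\<^sub>R ico3 + d *\<^sub>R ico4"
    "a \<in> Zphi" "b \<in> Zphi" "c \<in> Zphi" "d \<in> Zphi"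
proof -
  obtain c where "\<forall>b\<in>ico_basis. c b \<in> Zphi" "x = (\<Sum>b\<in>ico_basis. c b *\<^sub>R b)"
    using assms unfolding icosians_eq Zphi_span_def by blast
  then show ?thesis by (intro that[of "c 1" "c quat_i" "c ico3" "c ico4"]) (auto simp: ico_basis_sum)
qed

lemma icosians_basis: "1 \<in> icosians" "quat_i \<in> icosians" "ico3 \<in> icosians" "ico4 \<in> icosians"
  unfolding icosians_eq by (rule Zphi_span_base; simp)+

lemmas icosians_add = Zphi_span_add[of _ ico_basis, folded icosians_eq]
lemmas icosians_diff = Zphi_span_diff[of _ ico_basis, folded icosians_eq]
lemmas icosians_scale = Zphi_span_scale[of _ _ ico_basis, folded icosians_eq]
lemmas icosians_uminus = Zphi_span_uminus[of _ ico_basis, folded icosians_eq]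

text \<open>The structure constants of the icosian ring. All of them lie in Z[phi], which makes the
  span closed under products.\<close>

lemma ico_basis_mult:
  "quat_i * quat_i = - 1"
  "quat_i * ico3 = (phi - 2) *\<^sub>R 1 + (phi - 2) *\<^sub>R quat_i + ico3 + (2 * phi - 2) *\<^sub>R ico4"
  "quat_i * ico4 = (phi - 1) *\<^sub>R quat_i - phi *\<^sub>R ico3 - ico4"
  "ico3 * quat_i = (1 - phi) *\<^sub>R 1 + (3 - phi) *\<^sub>R quat_i - ico3 + (2 - 2 * phi) *\<^sub>R ico4"
  "ico3 * ico3 = - 1 + ico3"
  "ico3 * ico4 = (phi - 1) *\<^sub>R 1 + (2 * phi - 2) *\<^sub>R quat_i - phi *\<^sub>R ico3 + (phi - 2) *\<^sub>R ico4"
  "ico4 * quat_i = (1 - phi) *\<^sub>R 1 - phi *\<^sub>R quat_i + phi *\<^sub>R ico3 + ico4"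
  "ico4 * ico3 = (2 - phi) *\<^sub>R 1 + (2 - 2 * phi) *\<^sub>R quat_i + (phi - 1) *\<^sub>R ico3 + (3 - phi) *\<^sub>R ico4"
  "ico4 * ico4 = - 1 - ico4"
  by (simp_all add: ico_simps field_simps phi_simps)

lemma icosians_mult:
  assumes "x \<in> icosians" "y \<in> icosians" shows "x * y \<in> icosians"
proof -
  note closed = icosians_add icosians_diff icosians_uminus icosians_scale icosians_basis
    Zphi_diff Zphi_mult Zphi_simple Zphi_phi
  have "b * c \<in> icosians" if "b \<in> ico_basis" "c \<in> ico_basis" for b c
    using that unfolding insert_iff empty_iff
    by (elim disjE FalseE; simp only: ico_basis_mult mult_1 mult_1_right; intro closed)
  then show ?thesis using Zphi_span_mult[of ico_basis] assms unfolding icosians_eq by blast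
qed

lemma icosians_qcnj:
  assumes "x \<in> icosians" shows "qcnj x \<in> icosians"
proof -
  \<comment> \<open>The traces of \<open>quat_i\<close>, \<open>ico3\<close> and \<open>ico4\<close>
    are 0, 1 and -1.\<close>
  have "qcnj quat_i = - quat_i" "qcnj ico3 = 1 - ico3" "qcnj ico4 = - 1 - ico4"
    by (simp_all add: ico_simps)
  then have "qcnj b \<in> icosians" if "b \<in> ico_basis" for b
    using that icosians_basis icosians_uminus[OF icosians_basis(1)]
    by (auto intro: icosians_diff icosians_uminus)
  then show ?thesis using Zphi_span_linear_image[OF linear_qcnj] assms unfolding icosians_eq by blast
qed

text \<open>Elimination: in the basis only \<open>ico3\<close> has a k-component, and once it is
  gone only \<open>ico4\<close> has a j-component, so the real part gives \<open>r = a\<close>.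
  Traces and norms are brought into Z[phi] this way.\<close>

lemma icosians_scalar: "r \<in> Zphi" if "r *\<^sub>R 1 \<in> icosians"
proof -
  from that obtain a b c d where
    eq: "r *\<^sub>R 1 = a *\<^sub>R 1 + b *\<^sub>R quat_i + c *\<^sub>R ico3 + d *\<^sub>R ico4"
    and "a \<in> Zphi" by (rule icosiansE)
  have "c = 0" using arg_cong[OF eq, of qk] by (simp add: ico_simps)
  moreover from this have "d = 0" using arg_cong[OF eq, of qj] phi_bounds by (simp add: ico_simps)
  ultimately have "r = a" using arg_cong[OF eq, of q1] by (simp add: ico_simps)
  with \<open>a \<in> Zphi\<close> show ?thesis by simp
qed

lemma icosians_trace: "2 * q1 x \<in> Zphi" if "x \<in> icosians"
  using icosians_add[OF that icosians_qcnj[OF that]] unfolding qcnj_trace by (rule icosians_scalar)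

lemma icosians_norm: "qnorm2 x \<in> Zphi" if "x \<in> icosians"
  using icosians_mult[OF that icosians_qcnj[OF that]] unfolding mult_qcnj by (rule icosians_scalar)

lemma icosians_subset_quats_K: "icosians \<subseteq> quats_K"
proof
  fix x assume "x \<in> icosians"
  then obtain a b c d where x: "x = a *\<^sub>R 1 + b *\<^sub>R quat_i + c *\<^sub>R ico3 + d *\<^sub>R ico4"
    and Z: "a \<in> Zphi" "b \<in> Zphi" "c \<in> Zphi" "d \<in> Zphi" by (rule icosiansE)
  \<comment> \<open>Each coordinate is half of an element of Z[phi], and \<open>K5\<close> is closed
    under halving.\<close>
  have "q1 x = (2 * a + c - d) / 2" "qi x = (2 * b + c + d * (phi - 1)) / 2"
    "qj x = (c - d * phi) / 2" "qk x = c / 2"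
    unfolding x by (simp_all add: ico_simps field_simps)
  moreover have "2 * a + c - d \<in> Zphi" "2 * b + c + d * (phi - 1) \<in> Zphi" "c - d * phi \<in> Zphi"
    by (intro Zphi_add Zphi_diff Zphi_mult Z Zphi_simple Zphi_phi)+
  ultimately show "x \<in> quats_K"
    unfolding quats_K_def using Z(3) 
    by (simp only: mem_Collect_eq K5_half Zphi_subset_K5[THEN subsetD])
qed

text \<open>The elimination used for scalar icosians applies again: k-component, j-component, then
  the remaining two.\<close>

lemma ico_basis_independent: "Zphi_independent ico_basis"
  unfolding Zphi_independent_def
proof (intro allI impI, elim conjE)
  fix c assume "(\<Sum>b\<in>ico_basis. c b *\<^sub>R b) = 0"
  then have eq: "c 1 *\<^sub>R 1 + c quat_i *\<^sub>R quat_i + c ico3 *\<^sub>R ico3 + c ico4 *\<^sub>R ico4 = 0"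
    unfolding ico_basis_sum .
  have "c ico3 = 0" using arg_cong[OF eq, of qk] by (simp add: ico_simps)
  moreover from this have "c ico4 = 0"
    using arg_cong[OF eq, of qj] phi_bounds by (simp add: ico_simps)
  ultimately show "\<forall>b\<in>ico_basis. c b = 0"
    using arg_cong[OF eq, of q1] arg_cong[OF eq, of qi] by (simp add: ico_simps)
qed

subsection \<open>Integer coordinates\<close>

type_synonym zphi = "int \<times> int"
type_synonym icoord = "zphi \<times> zphi \<times> zphi \<times> zphi"

definition zval :: "zphi \<Rightarrow> real" where
  "zval = (\<lambda>(a, b). of_int a + of_int b * phi)"

text \<open>Coordinates of quaternions are doubled, so that those of icosians lie in \<open>\<int> + \<int>\<phi>\<close>.\<close>

definition qval :: "icoord \<Rightarrow> quat" where
  "qval = (\<lambda>(a, b, c, d). Quat (zval a / 2) (zval b / 2) (zval c / 2) (zval d / 2))"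

fun zadd :: "zphi \<Rightarrow> zphi \<Rightarrow> zphi" where
  "zadd (a, b) (c, d) = (a + c, b + d)"

fun zsub :: "zphi \<Rightarrow> zphi \<Rightarrow> zphi" where
  "zsub (a, b) (c, d) = (a - c, b - d)"

text \<open>Reduction by \<open>phi * phi = phi + 1\<close> gives the extra term
  \<open>b * d\<close> in both entries.\<close>

fun zmul :: "zphi \<Rightarrow> zphi \<Rightarrow> zphi" where
  "zmul (a, b) (c, d) = (a * c + b * d, a * d + b * c + b * d)"

fun zhalf :: "zphi \<Rightarrow> zphi" where
  "zhalf (a, b) = (a div 2, b div 2)"

fun zeven :: "zphi \<Rightarrow> bool" where
  "zeven (a, b) \<longleftrightarrow> a mod 2 = 0 \<and> b mod 2 = 0"

text \<open>Doubled factors yield four times the product, that is, twice its doubled coordinates;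
  one halving is still to follow.\<close>

fun qmul2 :: "icoord \<Rightarrow> icoord \<Rightarrow> icoord" where
  "qmul2 (a, b, c, d) (e, f, g, h) =
    (zsub (zsub (zsub (zmul a e) (zmul b f)) (zmul c g)) (zmul d h),
     zsub (zadd (zadd (zmul a f) (zmul b e)) (zmul c h)) (zmul d g),
     zadd (zadd (zsub (zmul a g) (zmul b h)) (zmul c e)) (zmul d f),
     zadd (zsub (zadd (zmul a h) (zmul b g)) (zmul c f)) (zmul d e))"

fun qhalf :: "icoord \<Rightarrow> icoord" where
  "qhalf (a, b, c, d) = (zhalf a, zhalf b, zhalf c, zhalf d)"

fun qeven :: "icoord \<Rightarrow> bool" where
  "qeven (a, b, c, d) \<longleftrightarrow> zeven a \<and> zeven b \<and> zeven c \<and> zeven d"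

text \<open>The halving is exact only if \<^const>\<open>qeven\<close> holds.\<close>

definition qmul :: "icoord \<Rightarrow> icoord \<Rightarrow> icoord" where
  "qmul x y = qhalf (qmul2 x y)"

lemma zval_simps:
  "zval (zadd x y) = zval x + zval y" "zval (zsub x y) = zval x - zval y"
  "zval (zmul x y) = zval x * zval y"
  by (cases x; cases y; simp add: zval_def algebra_simps phi_simps)+

lemma zval_half: "zeven x \<Longrightarrow> zval (zhalf x) = zval x / 2"
  by (cases x) (auto simp: zval_def elim!: evenE simp flip: even_iff_mod_2_eq_zero)

lemma qval_mul: "qeven (qmul2 x y) \<Longrightarrow> qval (qmul x y) = qval x * qval y"
  \<comment> \<open>The operations on pairs stay folded, so that \<open>zval_simps\<close> and
    \<open>zval_half\<close> can carry the formula over to the reals.\<close>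
  by (cases x rule: prod_cases4; cases y rule: prod_cases4)
    (simp add: qmul_def qval_def zval_simps zval_half times_quat_def field_simps
      del: zadd.simps zsub.simps zmul.simps zhalf.simps zeven.simps)

lemma inj_zval: "inj zval"
  by (rule injI) (auto simp: zval_def dest: phi_independent)

lemma inj_qval: "inj qval"
  using inj_zval by (auto intro!: injI simp: qval_def dest: injD)

section \<open>Coordinate lists of the 120 roots\<close>

definition unit_coords :: "icoord list" where
  "unit_coords = concat (map (\<lambda>s. [(s, (0,0), (0,0), (0,0)), ((0,0), s, (0,0), (0,0)),
     ((0,0), (0,0), s, (0,0)), ((0,0), (0,0), (0,0), s)]) [(2,0), (-2,0)])"

definition half_coords :: "icoord list" where
  "half_coords = concat (map (\<lambda>a. concat (map (\<lambda>b. concat (map (\<lambda>c. map (\<lambda>d. (a, b, c, d))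
     [(1,0), (-1,0)]) [(1,0), (-1,0)])) [(1,0), (-1,0)])) [(1,0), (-1,0)])"

text \<open>The alternating group on four letters, written out. The type is polymorphic to serve
  both real entries and integer pairs.\<close>

definition even_rearrangements :: "'a \<Rightarrow> 'a \<Rightarrow> 'a \<Rightarrow> 'a \<Rightarrow> ('a \<times> 'a \<times> 'a \<times> 'a) list" where
  "even_rearrangements a b c d =
    [(a,b,c,d), (a,c,d,b), (a,d,b,c), (b,a,d,c), (b,c,a,d), (b,d,c,a),
     (c,a,b,d), (c,b,d,a), (c,d,a,b), (d,a,c,b), (d,b,a,c), (d,c,b,a)]"

text \<open>Here \<open>(-1,1)\<close> is \<open>\<phi> - 1 = \<phi>\<^sup>-\<^sup>1\<close>.\<close>

definition golden_coords :: "icoord list" where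
  "golden_coords = concat (map (\<lambda>a. concat (map (\<lambda>b. concat (map (\<lambda>c.
     even_rearrangements (0,0) a b c)
     [(-1,1), (1,-1)])) [(0,1), (0,-1)])) [(1,0), (-1,0)])"

definition root_coords :: "icoord list" where
  "root_coords = unit_coords @ half_coords @ golden_coords"

lemma length_root_coords: "length root_coords = 120"
  by code_simp

lemma distinct_root_coords: "distinct root_coords"
  by code_simp

definition gen_coords :: "icoord list" where
  "gen_coords = [((0,0), (2,0), (0,0), (0,0)), ((1,0), (1,0), (1,0), (1,0)),
     ((-1,0), (-1,1), (0,-1), (0,0))]"

lemma gen_coords_eq: "map qval gen_coords = [quat_i, ico3, ico4]"
  by (simp add: gen_coords_def qval_def zval_def ico_simps)

text \<open>Evenness is tested together with membership, because exact halving is what makes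
  \<open>qmul\<close> agree with the quaternion product.\<close>

definition left_mul_stable :: "icoord list \<Rightarrow> icoord list \<Rightarrow> bool" where
  "left_mul_stable gs xs \<longleftrightarrow>
    list_all (\<lambda>g. list_all (\<lambda>x. let y = qmul2 g x in qeven y \<and> List.member xs (qhalf y)) xs) gs"

lemma gen_mul_root_coords: "left_mul_stable gen_coords root_coords"
  by code_simp

subsection \<open>The 120 roots\<close>

lemma ex_permutes_insert:
  "(\<exists>p. p permutes insert a S \<and> Q p) \<longleftrightarrow>
     (\<exists>b\<in>insert a S. \<exists>p. p permutes S \<and> Q (Transposition.transpose a b \<circ> p))"
  (is "?L \<longleftrightarrow> ?R")
proof
  assume ?L
  then obtain p where "p \<in> {p. p permutes insert a S}" "Q p" by blast
  then show ?R unfolding permutes_insert by auto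
next
  assume ?R
  then obtain b p where "b \<in> insert a S" "p permutes S" "Q (Transposition.transpose a b \<circ> p)" by blast
  then have "Transposition.transpose a b \<circ> p \<in> {p. p permutes insert a S}"
    unfolding permutes_insert by auto
  with \<open>Q (Transposition.transpose a b \<circ> p)\<close> show ?L by blast
qed

text \<open>Peeling off 0, 1 and 2 in turn writes each of the 24 permutations as three possibly
  trivial transpositions; on the remaining set \<open>{3}\<close> only the identity is left.\<close>

lemma ex_permutes_4:
  "(\<exists>p. p permutes {..<4::nat} \<and> Q p) \<longleftrightarrow>
     (\<exists>a\<in>{0, 1, 2, 3}. \<exists>b\<in>{1, 2, 3}. \<exists>c\<in>{2, 3}.
        Q (Transposition.transpose 0 a \<circ> (Transposition.transpose 1 b \<circ> Transposition.transpose 2 c)))"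
proof -
  have "{..<4::nat} = {0, 1, 2, 3}" by auto
  moreover have "(\<exists>p. p permutes {3::nat} \<and> R p) \<longleftrightarrow> R id" for R
    by (simp add: permutes_sing)
  ultimately show ?thesis
    by (simp only: ex_permutes_insert[of 0 "{1, 2, 3}"] ex_permutes_insert[of 1 "{2, 3}"]
        ex_permutes_insert[of 2 "{3}"] comp_id)
qed

text \<open>A factor is even exactly when its two points coincide, and a composition is even exactly
  when its factors have equal parity.\<close>

lemma evenperm_transpositions:
  "evenperm (Transposition.transpose a b \<circ> (Transposition.transpose c d \<circ> Transposition.transpose e f)) \<longleftrightarrow>
     ((a = b) \<longleftrightarrow> ((c = d) \<longleftrightarrow> (e = f)))" for a b c d e f :: nat
  by (simp add: evenperm_comp permutation_compose permutation_swap_id evenperm_swap)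

lemma permute_list_4:
  "permute_list p [w, x, y, z] = map (\<lambda>i. [w, x, y, z] ! p i) [0, 1, 2, 3]"
  by (simp add: permute_list_def upt_rec numeral_2_eq_2 numeral_3_eq_3)

lemma ex_permute_list_4:
  "(\<exists>p. p permutes {..<4} \<and> xs = permute_list p [a, b, b, b]) \<longleftrightarrow>
    xs \<in> {[a, b, b, b], [b, a, b, b], [b, b, a, b], [b, b, b, a]}"
  unfolding ex_permutes_4 permute_list_4
  \<comment> \<open>The 24 permutations produce each of the four lists six times; absorption removes
    the repetitions.\<close>
  by (simp add: Transposition.transpose_def) (simp only: disj_ac disj_absorb disj_left_absorb)

lemma ex_evenperm_list_4:
  "(\<exists>p. p permutes {..<4} \<and> evenperm p \<and> xs = permute_list p [a, b, c, d]) \<longleftrightarrow>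
    xs \<in> (\<lambda>(a, b, c, d). [a, b, c, d]) ` set (even_rearrangements a b c d)"
  unfolding ex_permutes_4 evenperm_transpositions permute_list_4
  by (simp add: even_rearrangements_def Transposition.transpose_def) (simp only: disj_ac)

lemma qval_root_coords: "x \<in> qval ` set root_coords \<longleftrightarrow>
  x \<in> qval ` set unit_coords \<or> x \<in> qval ` set half_coords \<or> x \<in> qval ` set golden_coords"
  by (auto simp: root_coords_def)

lemma qcoords_eq: "qcoords x = [a, b, c, d] \<longleftrightarrow> x = Quat a b c d"
  by (cases x) (simp add: qcoords_def)

section \<open>The three families of roots as coordinate lists\<close>

lemma S_H4_units:
  "(\<exists>p s. p permutes {..<4} \<and> s \<in> {1, -1} \<and> qcoords x = permute_list p [s, 0, 0, 0]) \<longleftrightarrow>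
    x \<in> qval ` set unit_coords"
proof -
  have "(\<exists>p s. p permutes {..<4} \<and> s \<in> {1, -1} \<and> qcoords x = permute_list p [s, 0, 0, 0]) \<longleftrightarrow>
    (\<exists>s\<in>{1, -1}. \<exists>p. p permutes {..<4} \<and> qcoords x = permute_list p [s, 0, 0, 0])" by blast
  also have "\<dots> \<longleftrightarrow> x \<in> qval ` set unit_coords"
    unfolding ex_permute_list_4
    by (simp add: qcoords_eq unit_coords_def qval_def zval_def)
  finally show ?thesis .
qed

lemma S_H4_halves:
  "(\<exists>a\<in>{1, -1}. \<exists>b\<in>{1, -1}. \<exists>c\<in>{1, -1}. \<exists>d\<in>{1, -1}. x = (1/2) *\<^sub>R Quat a b c d) \<longleftrightarrow>
    x \<in> qval ` set half_coords"
  by (simp add: half_coords_def qval_def zval_def scaleR_quat_def)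

lemma zval_pairs:
  "zval (0, 0) = 0" "zval (1, 0) = 1" "zval (-1, 0) = -1" "zval (0, 1) = phi" "zval (0, -1) = - phi"
  "zval (-1, 1) = inverse phi" "zval (1, -1) = - inverse phi"
  by (simp_all add: zval_def inverse_phi)

lemma qcoords_in_even_rearrangements:
  "qcoords x \<in> (\<lambda>(a, b, c, d). [a, b, c, d]) ` set (even_rearrangements
     (zval a / 2) (zval b / 2) (zval c / 2) (zval d / 2)) \<longleftrightarrow>
   x \<in> qval ` set (even_rearrangements a b c d)"
  by (simp add: even_rearrangements_def qcoords_eq qval_def)

lemma S_H4_golden:
  "(\<exists>p. p permutes {..<4} \<and> evenperm p \<and> (\<exists>a\<in>{1, -1}. \<exists>b\<in>{1, -1}. \<exists>c\<in>{1, -1}.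
     qcoords x = permute_list p [0, a / 2, b * phi / 2, c * inverse phi / 2])) \<longleftrightarrow>
    x \<in> qval ` set golden_coords"
proof -
  \<comment> \<open>Entries are rewritten as signed halves of \<open>zval\<close> values; the next
    step moves the signs into the pairs, so that \<open>qcoords_in_even_rearrangements\<close>
    applies.\<close>
  have "(\<exists>p. p permutes {..<4} \<and> evenperm p \<and> (\<exists>a\<in>{1, -1}. \<exists>b\<in>{1, -1}. \<exists>c\<in>{1, -1}.
     qcoords x = permute_list p [0, a / 2, b * phi / 2, c * inverse phi / 2])) \<longleftrightarrow>
    (\<exists>a\<in>{1, -1}. \<exists>b\<in>{1, -1}. \<exists>c\<in>{1, -1}. \<exists>p. p permutes {..<4} \<and> evenperm p \<and>
     qcoords x = permute_list p
       [zval (0, 0) / 2, a * zval (1, 0) / 2, b * zval (0, 1) / 2, c * zval (-1, 1) / 2])"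
    by (simp only: zval_pairs div_0 mult_1_right) blast
  also have "\<dots> \<longleftrightarrow> (\<exists>a\<in>{(1, 0), (-1, 0)}. \<exists>b\<in>{(0, 1), (0, -1)}. \<exists>c\<in>{(-1, 1), (1, -1)}.
     x \<in> qval ` set (even_rearrangements (0, 0) a b c))"
    unfolding ex_evenperm_list_4 qcoords_in_even_rearrangements[symmetric]
    by (simp add: zval_pairs)
  also have "\<dots> \<longleftrightarrow> x \<in> qval ` set golden_coords"
    by (simp add: golden_coords_def image_Un)
  finally show ?thesis .
qed

lemma S_H4_eq: "S_H4 = qval ` set root_coords"
  unfolding set_eq_iff qval_root_coords S_H4_units[symmetric] S_H4_halves[symmetric]
    S_H4_golden[symmetric] S_H4_def
  by blast

subsection \<open>Generation by the basis icosians\<close>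

text \<open>With w the product of \<open>gs\<close>, these are the elements w^k x for x in
  \<open>xs\<close> and k < n; the exponent n is excluded.\<close>

fun translates :: "icoord list \<Rightarrow> nat \<Rightarrow> icoord list \<Rightarrow> icoord list" where
  "translates gs 0 xs = []" |
  "translates gs (Suc n) xs = xs @ translates gs n (map (foldr qmul gs) xs)"

text \<open>The list follows a chain of subgroups of orders 8, 24 and 120. Powers of
  \<open>i\<close> and of \<open>w i w w\<close>, which is -j, give the quaternion group; three
  powers of \<open>w\<close> extend it to the Hurwitz units; five powers of \<open>v i\<close>
  represent the cosets of these. In all there are 4 * 2 * 3 * 5 = 120 words.\<close>

definition generated_coords :: "icoord list" where
  "generated_coords =
    (let i = gen_coords ! 0; w = gen_coords ! 1; v = gen_coords ! 2
     in translates [v, i] 5 (translates [w] 3 (translates [w, i, w, w] 2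
          (translates [i] 4 [((2,0), (0,0), (0,0), (0,0))]))))"

definition sublist_of :: "icoord list \<Rightarrow> icoord list \<Rightarrow> bool" where
  "sublist_of xs ys \<longleftrightarrow> list_all (List.member ys) xs"

lemma root_coords_generated: "sublist_of root_coords generated_coords"
  by code_simp

subsection \<open>The root system on the quaternions\<close>

lemma gen_mul_root_coordsD:
  assumes "g \<in> set gen_coords" "t \<in> set root_coords"
  shows "qmul g t \<in> set root_coords" "qval (qmul g t) = qval g * qval t"
proof -
  have "qeven (qmul2 g t) \<and> qmul g t \<in> set root_coords"
    using gen_mul_root_coords assms
    by (auto simp: left_mul_stable_def list_all_iff qmul_def Let_def)
  then show "qmul g t \<in> set root_coords" "qval (qmul g t) = qval g * qval t"
    by (simp_all add: qval_mul)
qed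

lemma qval_gen_coords: "g \<in> set gen_coords \<Longrightarrow> qval g \<in> {quat_i, ico3, ico4}"
  using arg_cong[OF gen_coords_eq, of set] by auto

lemma translates_subset:
  assumes "\<And>g x. g \<in> set gs \<Longrightarrow> x \<in> A \<Longrightarrow> qmul g x \<in> A" "set xs \<subseteq> A"
  shows "set (translates gs n xs) \<subseteq> A"
  using assms(2)
proof (induction n arbitrary: xs)
  case (Suc n)
  have "foldr qmul hs x \<in> A" if "set hs \<subseteq> set gs" "x \<in> A" for hs x
    using that by (induction hs) (auto intro: assms(1))
  then have "set (map (foldr qmul gs) xs) \<subseteq> A" using Suc.prems by auto
  then show ?case using Suc.IH[of "map (foldr qmul gs) xs"] Suc.prems by simp
qed simp

lemma S_H4_gen_mult:
  assumes "g \<in> {quat_i, ico3, ico4}" "x \<in> S_H4"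
  shows "g * x \<in> S_H4"
proof -
  have "g \<in> qval ` set gen_coords"
    using assms(1) arg_cong[OF gen_coords_eq, of set] by auto
  then obtain k where k: "k \<in> set gen_coords" "g = qval k" by auto
  obtain t where t: "t \<in> set root_coords" "x = qval t"
    using assms(2) unfolding S_H4_eq by auto
  show ?thesis
    unfolding S_H4_eq k(2) t(2) gen_mul_root_coordsD(2)[OF k(1) t(1), symmetric]
    by (rule imageI) (rule gen_mul_root_coordsD(1)[OF k(1) t(1)])
qed

text \<open>The root coordinates at which \<open>P\<close> holds include 1 and are stable under left
  multiplication by generators, so they contain \<open>generated_coords\<close> and hence all
  roots.\<close>

lemma S_H4_induct [consumes 1, case_names one gen]:
  assumes "x \<in> S_H4" "P 1"
    and step: "\<And>g x. g \<in> {quat_i, ico3, ico4} \<Longrightarrow> x \<in> S_H4 \<Longrightarrow> P x \<Longrightarrow> P (g * x)"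
  shows "P x"
proof -
  define A where "A = {t \<in> set root_coords. P (qval t)}"
  have closed: "qmul g t \<in> A" if "g \<in> set gen_coords" "t \<in> A" for g t
    using that gen_mul_root_coordsD step[OF qval_gen_coords[OF that(1)], of "qval t"]
    unfolding A_def S_H4_eq by auto
  have "((2,0), (0,0), (0,0), (0,0)) \<in> A"
    using \<open>P 1\<close> by (simp add: A_def root_coords_def unit_coords_def qval_def zval_def one_quat_def)
  moreover have "gen_coords ! 0 \<in> set gen_coords" "gen_coords ! 1 \<in> set gen_coords"
    "gen_coords ! 2 \<in> set gen_coords" by (simp_all add: gen_coords_def)
  ultimately have "set generated_coords \<subseteq> A"
    unfolding generated_coords_def Let_def by (intro translates_subset closed) auto
  moreover have "set root_coords \<subseteq> set generated_coords"
    using root_coords_generated by (auto simp: sublist_of_def list_all_iff)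
  ultimately show ?thesis using assms(1) unfolding S_H4_eq A_def by auto
qed

section \<open>The roots as a group of norm-one icosians\<close>

lemma card_S_H4: "card S_H4 = 120"
  unfolding S_H4_eq card_image[OF inj_on_subset[OF inj_qval subset_UNIV]]
  by (simp add: distinct_card[OF distinct_root_coords] length_root_coords)

lemma finite_S_H4: "finite S_H4"
  unfolding S_H4_eq by simp

lemma S_H4_one: "1 \<in> S_H4"
  unfolding S_H4_eq
  by (rule image_eqI[of _ _ "((2,0), (0,0), (0,0), (0,0))"])
    (simp_all add: root_coords_def unit_coords_def qval_def zval_def one_quat_def)

lemma S_H4_gens: "quat_i \<in> S_H4" "ico3 \<in> S_H4" "ico4 \<in> S_H4"
  using S_H4_gen_mult[OF _ S_H4_one] by simp_all

lemma S_H4_mult: "x \<in> S_H4 \<Longrightarrow> y \<in> S_H4 \<Longrightarrow> x * y \<in> S_H4"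
  by (induction x rule: S_H4_induct) (auto simp: mult.assoc intro: S_H4_gen_mult)

lemma S_H4_uminus: "- x \<in> S_H4" if "x \<in> S_H4"
  using S_H4_mult[OF S_H4_mult[OF S_H4_gens(1) S_H4_gens(1)] that] by (simp add: ico_basis_mult)

lemma S_H4_qcnj: "x \<in> S_H4 \<Longrightarrow> qcnj x \<in> S_H4"
proof (induction x rule: S_H4_induct)
  case (gen g x)
  \<comment> \<open>For norm one, conjugates are inverses; the cube of \<open>ico3\<close> is -1 and
    that of \<open>ico4\<close> is 1.\<close>
  have "qcnj quat_i = - quat_i" "qcnj ico3 = - (ico3 * ico3)" "qcnj ico4 = ico4 * ico4"
    unfolding ico_basis_mult by (simp_all add: ico_simps)
  then have "qcnj g \<in> S_H4" using gen(1) S_H4_gens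
      S_H4_uminus[OF S_H4_gens(1)] S_H4_uminus[OF S_H4_mult[OF S_H4_gens(2) S_H4_gens(2)]]
      S_H4_mult[OF S_H4_gens(3) S_H4_gens(3)] by auto
  then show ?case using gen(3) by (simp add: qcnj_mult S_H4_mult)
qed (simp add: S_H4_one)

lemma S_H4_qnorm2: "x \<in> S_H4 \<Longrightarrow> qnorm2 x = 1"
proof (induction x rule: S_H4_induct)
  case (gen g x)
  have "qnorm2 quat_i = 1" "qnorm2 ico3 = 1" "qnorm2 ico4 = 1"
    by (simp_all add: qnorm2_def ico_simps power2_eq_square field_simps phi_simps)
  then show ?case using gen by (auto simp: qnorm2_mult)
qed (simp add: qnorm2_def one_quat_def)

lemma S_H4_subset_icosians: "S_H4 \<subseteq> icosians"
proof
  show "x \<in> icosians" if "x \<in> S_H4" for x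
    using that by (induction x rule: S_H4_induct) (auto intro: icosians_mult icosians_basis)
qed

lemma S_H4_reflection:
  assumes "x \<in> S_H4" "y \<in> S_H4"
  shows "y - (2 * q1 (y * qcnj x)) *\<^sub>R x \<in> S_H4"
proof -
  \<comment> \<open>Twice the real part is a trace. Since \<open>qcnj x * x\<close> is 1, the first
    term of the expansion is \<open>y\<close> and cancels.\<close>
  have "(2 * q1 (y * qcnj x)) *\<^sub>R x = (y * qcnj x + qcnj (y * qcnj x)) * x"
    unfolding qcnj_trace by simp
  also have "\<dots> = y * (qcnj x * x) + x * qcnj y * x"
    by (simp add: qcnj_mult distrib_right mult.assoc)
  also have "qcnj x * x = 1" using S_H4_qnorm2[OF assms(1)] by (simp add: qcnj_mult_self)
  finally have "y - (2 * q1 (y * qcnj x)) *\<^sub>R x = - (x * qcnj y * x)" by simp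
  then show ?thesis using assms by (simp add: S_H4_uminus S_H4_mult S_H4_qcnj)
qed

section \<open>A simple system of type H4\<close>

lemma cos_pi_fifth: "cos (pi / 5) = phi / 2"
proof -
  define c where "c = cos (pi / 5)"
  have "c > 0" unfolding c_def by (rule cos_gt_zero) simp_all
  \<comment> \<open>The two angles add up to pi; the multiple angle formulas turn this into a cubic
    equation for \<open>c\<close> with the extraneous root -1.\<close>
  have "cos (3 * (pi / 5)) = - cos (2 * (pi / 5))"
    using cos_pi_minus[of "2 * (pi / 5)"] by (simp add: field_simps)
  then have "4 * c ^ 3 - 3 * c = - (2 * c\<^sup>2 - 1)"
    unfolding cos_double_cos cos_treble_cos c_def .
  then have "(c + 1) * (4 * c\<^sup>2 - 2 * c - 1) = 0" by algebra
  with \<open>c > 0\<close> have "4 * c\<^sup>2 - 2 * c - 1 = 0" by simp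
  \<comment> \<open>The roots of the quadratic are \<open>phi / 2\<close> and
    \<open>(1 - phi) / 2\<close>; the second is negative.\<close>
  then have "(2 * c - phi) * (2 * c + phi - 1) = 0" using phi_squared by algebra
  moreover have "2 * c + phi - 1 > 0" using \<open>c > 0\<close> phi_bounds by simp
  ultimately show ?thesis unfolding c_def by simp
qed

text \<open>The numbering follows the diagram, with the bond 5 between the first two roots.\<close>

definition simple_root :: "nat \<Rightarrow> quat" where
  "simple_root n = qval ([((2,0), (0,0), (0,0), (0,0)), ((0,-1), (0,0), (1,0), (-1,1)),
     ((0,0), (0,0), (-2,0), (0,0)), ((0,0), (-1,1), (1,0), (0,-1))] ! n)"

lemma less_4_cases: "n < 4 \<Longrightarrow> n = 0 \<or> n = 1 \<or> n = 2 \<or> n = (3::nat)"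
  by linarith

lemma lessThan_4: "{..<4::nat} = {0, 1, 2, 3}"
  by auto

lemma simple_root_simps:
  "simple_root 0 = Quat 1 0 0 0" "simple_root 1 = Quat (- phi / 2) 0 (1 / 2) ((phi - 1) / 2)"
  "simple_root (Suc 0) = Quat (- phi / 2) 0 (1 / 2) ((phi - 1) / 2)"
  "simple_root 2 = Quat 0 0 (- 1) 0" "simple_root 3 = Quat 0 ((phi - 1) / 2) (1 / 2) (- phi / 2)"
  by (simp_all add: simple_root_def qval_def zval_def)

lemma simple_root_in_S_H4: "n < 4 \<Longrightarrow> simple_root n \<in> S_H4"
  unfolding S_H4_eq simple_root_def
  by (rule imageI, drule less_4_cases, elim disjE;
      simp add: root_coords_def unit_coords_def golden_coords_def even_rearrangements_def)

lemma inner_simple_roots: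
  assumes "i < 4" "j < 4"
  shows "q1 (simple_root i * qcnj (simple_root j)) = cos (pi - pi / real (coxeter_H4 i j))"
proof -
  \<comment> \<open>The labels 5, 3 and 2; the label 1 on the diagonal gives cos 0.\<close>
  have "cos (pi - pi / 5) = - phi / 2" "cos (pi - pi / 3) = - 1 / 2" "cos (pi - pi / 2) = 0"
    unfolding cos_pi_minus cos_pi_fifth cos_60 cos_pi_half by simp_all
  then show ?thesis
    using less_4_cases[OF assms(1)] less_4_cases[OF assms(2)]
    by (elim disjE)
      (simp_all add: simple_root_simps coxeter_H4_def doubleton_eq_iff Quat_simps field_simps phi_simps)
qed

text \<open>Scalar products of doubled coordinates with the basis dual to \<^const>\<open>simple_root\<close>.\<close>

definition dual_coords :: "icoord \<Rightarrow> zphi list" where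
  "dual_coords = (\<lambda>(a, b, c, d).
     [zadd (zadd a (zmul (2,3) b)) (zmul (1,1) d), zadd (zmul (2,4) b) (zmul (0,2) d),
      zadd (zsub (zmul (1,3) b) c) (zmul (0,1) d), zmul (0,2) b])"

text \<open>As \<open>phi\<close> is positive, a + b \<open>phi\<close> takes the common sign of a
  and b. This sufficient test needs only integers, and all roots pass it.\<close>

definition same_signs :: "zphi list \<Rightarrow> bool" where
  "same_signs zs \<longleftrightarrow> list_all (\<lambda>(a, b). 0 \<le> a \<and> 0 \<le> b) zs \<or> list_all (\<lambda>(a, b). a \<le> 0 \<and> b \<le> 0) zs"

lemma root_coords_same_signs: "list_all (\<lambda>t. same_signs (dual_coords t)) root_coords"
  by code_simp

text \<open>The real counterpart of \<open>dual_coords\<close>: coordinates in the simple roots, for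
  arbitrary quaternions.\<close>

definition simple_coeff :: "quat \<Rightarrow> nat \<Rightarrow> real" where
  "simple_coeff x n =
     [q1 x + (2 + 3 * phi) * qi x + (1 + phi) * qk x, (2 + 4 * phi) * qi x + 2 * phi * qk x,
      (1 + 3 * phi) * qi x - qj x + phi * qk x, 2 * phi * qi x] ! n"

lemma simple_root_expansion: "x = (\<Sum>n<4. simple_coeff x n *\<^sub>R simple_root n)"
  unfolding lessThan_4
  by (cases x) (simp add: simple_coeff_def simple_root_simps quat_defs field_simps phi_simps)

lemma simple_coeff_qval:
  "n < 4 \<Longrightarrow> simple_coeff (qval t) n = zval (dual_coords t ! n) / 2"
proof -
  assume "n < 4"
  have "zval (2,3) = 2 + 3 * phi" "zval (1,1) = 1 + phi" "zval (2,4) = 2 + 4 * phi"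
    "zval (0,2) = 2 * phi" "zval (1,3) = 1 + 3 * phi" "zval (0,1) = phi"
    by (simp_all add: zval_def)
  moreover obtain a b c d where "t = (a, b, c, d)" by (rule prod_cases4)
  ultimately show "simple_coeff (qval t) n = zval (dual_coords t ! n) / 2"
    using less_4_cases[OF \<open>n < 4\<close>]
    by (elim disjE) (simp_all add: simple_coeff_def dual_coords_def qval_def zval_simps field_simps)
qed

lemma simple_coeff_signs:
  assumes "x \<in> S_H4"
  shows "(\<forall>n<4. 0 \<le> simple_coeff x n) \<or> (\<forall>n<4. simple_coeff x n \<le> 0)"
proof -
  obtain t where t: "x = qval t" "t \<in> set root_coords" using assms unfolding S_H4_eq by auto
  have len: "length (dual_coords t) = 4" by (cases t rule: prod_cases4) (simp add: dual_coords_def)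
  have pos: "0 \<le> zval z" if "list_all (\<lambda>(a, b). 0 \<le> a \<and> 0 \<le> b) zs" "z \<in> set zs" for z zs
    using that phi_bounds by (auto simp: list_all_iff zval_def split_beta)
  have neg: "zval z \<le> 0" if "list_all (\<lambda>(a, b). a \<le> 0 \<and> b \<le> 0) zs" "z \<in> set zs" for z zs
    using that phi_bounds
    by (auto simp: list_all_iff zval_def split_beta intro!: add_nonpos_nonpos mult_nonpos_nonneg)
  have "same_signs (dual_coords t)" using root_coords_same_signs t(2) by (simp add: list_all_iff)
  moreover have "dual_coords t ! n \<in> set (dual_coords t)" if "n < 4" for n
    using that len by simp
  ultimately have "(\<forall>n<4. 0 \<le> zval (dual_coords t ! n)) \<or> (\<forall>n<4. zval (dual_coords t ! n) \<le> 0)"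
    unfolding same_signs_def using pos neg by meson
  then show ?thesis unfolding t(1) by (simp add: simple_coeff_qval)
qed

text \<open>Only the last simple root has an i-component, and only it and the second have a
  k-component; the real part and the j-component settle the other two.\<close>

lemma simple_root_independent:
  assumes "(\<Sum>n<4. c n *\<^sub>R simple_root n) = 0" "n < 4"
  shows "c n = 0"
proof -
  have eq: "c 0 *\<^sub>R simple_root 0 + (c 1 *\<^sub>R simple_root 1 +
      (c 2 *\<^sub>R simple_root 2 + c 3 *\<^sub>R simple_root 3)) = 0"
    using assms(1) unfolding lessThan_4 by simp
  have "c 3 = 0" using arg_cong[OF eq, of qi] phi_bounds by (simp add: simple_root_simps quat_defs)
  moreover from this have "c 1 = 0"
    using arg_cong[OF eq, of qk] phi_bounds by (simp add: simple_root_simps quat_defs)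
  ultimately have "c 2 = 0" "c 0 = 0"
    using arg_cong[OF eq, of q1] arg_cong[OF eq, of qj] by (simp_all add: simple_root_simps quat_defs)
  with \<open>c 3 = 0\<close> \<open>c 1 = 0\<close> show ?thesis using less_4_cases[OF assms(2)] by auto
qed

lemma span_S_H4: "span S_H4 = UNIV"
proof -
  have "(\<Sum>n<4. simple_coeff x n *\<^sub>R simple_root n) \<in> span S_H4" for x
    by (intro span_sum span_scale span_base simple_root_in_S_H4) simp
  then show ?thesis unfolding simple_root_expansion[symmetric] by blast
qed

subsection \<open>The icosian double\<close>

lemma refl_root_involution: "refl_root \<alpha> (refl_root \<alpha> v) = v"
  \<comment> \<open>For the zero vector the quotient in \<open>cartan\<close> is 0 by convention,
    and the reflection is the identity.\<close>
  by (cases "\<alpha> = 0") (simp_all add: refl_root_def cartan_def inner_diff_left)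

text \<open>Unit length forces proportional roots to differ by a factor 1 or -1, and an involution
  that maps the set into itself maps it onto itself.\<close>

lemma root_system_unit_vectors:
  assumes "finite \<Phi>" and norm: "\<And>\<alpha>. \<alpha> \<in> \<Phi> \<Longrightarrow> norm \<alpha> = 1"
    and minus: "\<And>\<alpha>. \<alpha> \<in> \<Phi> \<Longrightarrow> - \<alpha> \<in> \<Phi>" and span: "span \<Phi> = V"
    and refl: "\<And>\<alpha> \<beta>. \<alpha> \<in> \<Phi> \<Longrightarrow> \<beta> \<in> \<Phi> \<Longrightarrow> refl_root \<alpha> \<beta> \<in> \<Phi>"
  shows "root_system V \<Phi>"
proof -
  have "\<Phi> \<inter> span {\<alpha>} = {\<alpha>, - \<alpha>}" if "\<alpha> \<in> \<Phi>" for \<alpha>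
  proof
    show "\<Phi> \<inter> span {\<alpha>} \<subseteq> {\<alpha>, - \<alpha>}"
    proof
      fix \<beta> assume "\<beta> \<in> \<Phi> \<inter> span {\<alpha>}"
      then obtain c where c: "\<beta> = c *\<^sub>R \<alpha>" "\<beta> \<in> \<Phi>" by (auto simp: span_singleton)
      then have "\<bar>c\<bar> = 1" using norm[OF c(2)] norm[OF that] by simp
      then show "\<beta> \<in> {\<alpha>, - \<alpha>}" unfolding c(1) by (auto simp: abs_if split: if_splits)
    qed
    show "{\<alpha>, - \<alpha>} \<subseteq> \<Phi> \<inter> span {\<alpha>}"
      using that minus by (auto intro: span_base span_neg)
  qed
  moreover have "refl_root \<alpha> ` \<Phi> = \<Phi>" if "\<alpha> \<in> \<Phi>" for \<alpha>
  proof
    show "refl_root \<alpha> ` \<Phi> \<subseteq> \<Phi>" using refl[OF that] by blast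
    show "\<Phi> \<subseteq> refl_root \<alpha> ` \<Phi>"
    proof
      fix \<beta> assume "\<beta> \<in> \<Phi>"
      then show "\<beta> \<in> refl_root \<alpha> ` \<Phi>"
        using refl[OF that] refl_root_involution[of \<alpha> \<beta>] by (intro image_eqI[of _ _ "refl_root \<alpha> \<beta>"]) auto
    qed
  qed
  moreover have "0 \<notin> \<Phi>" using norm by fastforce
  ultimately show ?thesis unfolding root_system_def using assms(1) span by blast
qed

text \<open>The type \<open>quat\<close> carries no inner product, so the form Re(x cnj y) is
  written out. An abstract embedding treats both summands of the octonions at once.\<close>

definition quat_isometry :: "(quat \<Rightarrow> 'a::real_inner) \<Rightarrow> bool" where
  "quat_isometry h \<longleftrightarrow> linear h \<and> (\<forall>x y. inner (h x) (h y) = q1 (x * qcnj y))"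

section \<open>Transport of the H4 system along an isometric embedding\<close>

context
  fixes h :: "quat \<Rightarrow> 'a::real_inner"
  assumes h: "quat_isometry h"
begin

lemma linear_isometry: "linear h"
  using h unfolding quat_isometry_def by blast

lemma inner_isometry: "inner (h x) (h y) = q1 (x * qcnj y)"
  using h unfolding quat_isometry_def by blast

lemma norm_isometry: "norm (h x) = sqrt (qnorm2 x)"
  by (simp add: norm_eq_sqrt_inner inner_isometry mult_qcnj)

lemma inj_isometry: "inj h"
proof (subst linear_injective_0[OF linear_isometry], intro allI impI)
  fix x assume "h x = 0"
  then have "qnorm2 x = 0" using norm_isometry[of x] by (simp add: qnorm2_def)
  then show "x = 0"
    by (cases x) (simp add: qnorm2_def zero_quat_def add_nonneg_eq_0_iff)
qed

lemma cartan_isometry: "x \<in> S_H4 \<Longrightarrow> cartan (h y) (h x) = 2 * q1 (y * qcnj x)"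
  by (simp add: cartan_def inner_isometry mult_qcnj S_H4_qnorm2)

lemma refl_root_isometry:
  "x \<in> S_H4 \<Longrightarrow> refl_root (h x) (h y) = h (y - (2 * q1 (y * qcnj x)) *\<^sub>R x)"
  by (simp add: refl_root_def cartan_isometry linear_diff[OF linear_isometry]
      linear_scale[OF linear_isometry])

lemma refl_root_isometry_closed:
  "x \<in> S_H4 \<Longrightarrow> y \<in> S_H4 \<Longrightarrow> refl_root (h x) (h y) \<in> h ` S_H4"
  by (simp add: refl_root_isometry S_H4_reflection)

lemma span_isometry: "span (h ` S_H4) = range h"
  by (simp add: linear_span_image[OF linear_isometry] span_S_H4)

lemma root_system_isometry: "root_system (range h) (h ` S_H4)"
proof (rule root_system_unit_vectors)
  show "- \<alpha> \<in> h ` S_H4" if "\<alpha> \<in> h ` S_H4" for \<alpha>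
    using that S_H4_uminus by (auto simp flip: linear_neg[OF linear_isometry])
qed (auto simp: finite_S_H4 norm_isometry S_H4_qnorm2 refl_root_isometry_closed span_isometry)

lemma sum_simple_roots_isometry: "(\<Sum>n<4. c n *\<^sub>R h (simple_root n)) = h (\<Sum>n<4. c n *\<^sub>R simple_root n)"
  by (simp add: linear_sum[OF linear_isometry] linear_scale[OF linear_isometry])

lemma inj_on_simple_roots: "inj_on (\<lambda>n. h (simple_root n)) {..<4}"
  by (rule inj_onI) (auto dest!: injD[OF inj_isometry] less_4_cases simp: simple_root_simps)

lemma simple_system_isometry: "simple_system (h ` S_H4) ((\<lambda>n. h (simple_root n)) ` {..<4})"
  unfolding simple_system_def
proof (intro conjI ballI)
  let ?a = "\<lambda>n. h (simple_root n)"
  \<comment> \<open>Sums over the set of simple roots become sums over their indices.\<close>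
  note sum_a = sum.reindex[OF inj_on_simple_roots, unfolded o_def]
  show "finite (?a ` {..<4})" by simp
  show "?a ` {..<4} \<subseteq> h ` S_H4" using simple_root_in_S_H4 by auto
  show "independent (?a ` {..<4})"
  proof (rule independent_if_scalars_zero)
    fix c x assume "(\<Sum>v\<in>?a ` {..<4}. c v *\<^sub>R v) = 0" and "x \<in> ?a ` {..<4}"
    then obtain n where n: "n < 4" "x = ?a n" by blast
    have "h (\<Sum>n<4. c (?a n) *\<^sub>R simple_root n) = h 0"
      using \<open>(\<Sum>v\<in>?a ` {..<4}. c v *\<^sub>R v) = 0\<close>
      by (simp add: sum_a sum_simple_roots_isometry linear_0[OF linear_isometry])
    then show "c x = 0"
      using simple_root_independent[of "\<lambda>n. c (?a n)" n] injD[OF inj_isometry] n by blast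
  qed simp
  fix \<beta> assume "\<beta> \<in> h ` S_H4"
  then obtain x where x: "x \<in> S_H4" "\<beta> = h x" by blast
  \<comment> \<open>A simple system takes coefficients indexed by vectors, so the injective
    numbering is inverted.\<close>
  define c where "c v = simple_coeff x (the_inv_into {..<4} ?a v)" for v
  have c: "c (?a n) = simple_coeff x n" if "n < 4" for n
    using that by (simp add: c_def the_inv_into_f_f[OF inj_on_simple_roots])
  have "\<beta> = (\<Sum>n<4. simple_coeff x n *\<^sub>R ?a n)"
    unfolding sum_simple_roots_isometry simple_root_expansion[symmetric] by (rule x(2))
  also have "\<dots> = (\<Sum>v\<in>?a ` {..<4}. c v *\<^sub>R v)"
    unfolding sum_a by (rule sum.cong) (simp_all add: c)
  finally have "\<beta> = (\<Sum>v\<in>?a ` {..<4}. c v *\<^sub>R v)" .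
  moreover have "(\<forall>v\<in>?a ` {..<4}. 0 \<le> c v) \<or> (\<forall>v\<in>?a ` {..<4}. c v \<le> 0)"
    using simple_coeff_signs[OF x(1)] by (auto simp: c)
  ultimately show "\<exists>c. \<beta> = (\<Sum>v\<in>?a ` {..<4}. c v *\<^sub>R v) \<and>
      ((\<forall>v\<in>?a ` {..<4}. 0 \<le> c v) \<or> (\<forall>v\<in>?a ` {..<4}. c v \<le> 0))" by blast
qed

lemma root_system_H4_isometry: "root_system_H4 (range h) (h ` S_H4)"
  unfolding root_system_H4_def has_coxeter_matrix_def
  using root_system_isometry inj_on_simple_roots simple_system_isometry
  by (auto intro!: exI[of _ "\<lambda>n. h (simple_root n)"]
      simp: inner_isometry inner_simple_roots norm_isometry S_H4_qnorm2 simple_root_in_S_H4)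

end

section \<open>The 240 roots in the octonions\<close>

lemma quat_isometry_Oct: "quat_isometry (\<lambda>a. Oct a 0)" "quat_isometry (Oct 0)"
  by (auto intro!: linearI simp: quat_isometry_def inner_octonion_coords octonion_defs Quat_simps)

lemma inj_on_Oct: "inj_on (\<lambda>a. Oct a 0) A" "inj_on (Oct 0) A"
  by (simp_all add: inj_on_def)

lemma S_left_eq: "S_left = (\<lambda>a. Oct a 0) ` S_H4" and S_right_eq: "S_right = Oct 0 ` S_H4"
  unfolding S_left_def S_right_def by auto

lemma S_G_cases [consumes 1, case_names left right]:
  assumes "x \<in> S_G"
  obtains a where "a \<in> S_H4" "x = Oct a 0" | b where "b \<in> S_H4" "x = Oct 0 b"
  using assms unfolding S_G_def S_left_eq S_right_eq by blast

lemma S_G_intros: "a \<in> S_H4 \<Longrightarrow> Oct a 0 \<in> S_G" "a \<in> S_H4 \<Longrightarrow> Oct 0 a \<in> S_G"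
  unfolding S_G_def S_left_eq S_right_eq by auto

lemma inner_left_right: "inner (Oct a 0) (Oct 0 b) = 0" "inner (Oct 0 b) (Oct a 0) = 0"
  by (simp_all add: inner_octonion_coords zero_quat_def)

lemma S_G_norm: "x \<in> S_G \<Longrightarrow> norm x = 1"
  by (cases x rule: S_G_cases)
    (simp_all add: norm_isometry[OF quat_isometry_Oct(1)] norm_isometry[OF quat_isometry_Oct(2)] S_H4_qnorm2)

lemma S_G_uminus: "x \<in> S_G \<Longrightarrow> - x \<in> S_G"
  by (cases x rule: S_G_cases) (auto simp: uminus_octonion_def intro!: S_G_intros S_H4_uminus)

text \<open>Within a summand the coefficient is the trace of an icosian; across summands it vanishes
  by orthogonality.\<close>

lemma S_G_cartan:
  assumes "x \<in> S_G" "y \<in> S_G"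
  shows "cartan y x \<in> Zphi"
proof -
  have "2 * q1 (b * qcnj a) \<in> Zphi" if "a \<in> S_H4" "b \<in> S_H4" for a b
    using that S_H4_subset_icosians by (intro icosians_trace icosians_mult icosians_qcnj) auto
  then show ?thesis
    using assms
    by (elim S_G_cases) (simp_all add: cartan_isometry[OF quat_isometry_Oct(1)]
        cartan_isometry[OF quat_isometry_Oct(2)] cartan_def[of "Oct 0 _" "Oct _ 0"]
        cartan_def[of "Oct _ 0" "Oct 0 _"] inner_left_right)
qed

lemma S_G_refl_root:
  assumes "x \<in> S_G" "y \<in> S_G"
  shows "refl_root x y \<in> S_G"
proof -
  \<comment> \<open>A reflection in a root of one summand fixes the other summand.\<close>
  have orth: "refl_root (Oct a 0) (Oct 0 b) = Oct 0 b" "refl_root (Oct 0 b) (Oct a 0) = Oct a 0" for a b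
    by (simp_all add: refl_root_def cartan_def inner_left_right)
  show ?thesis
    using assms refl_root_isometry_closed[OF quat_isometry_Oct(1)]
      refl_root_isometry_closed[OF quat_isometry_Oct(2)]
    by (elim S_G_cases) (auto simp: orth S_G_intros S_G_def S_left_eq S_right_eq)
qed

lemma card_S_G: "card S_G = 240"
proof -
  have "S_left \<inter> S_right = {}"
  proof (rule ccontr)
    assume "S_left \<inter> S_right \<noteq> {}"
    \<comment> \<open>A common element has both components zero, so 0 would be a root, against norm
      one.\<close>
    then have "0 \<in> S_H4" unfolding S_left_eq S_right_eq by auto
    then show False using S_H4_qnorm2[of 0] by (simp add: qnorm2_def zero_quat_def)
  qed
  moreover have "card S_left = 120" "card S_right = 120"
    unfolding S_left_eq S_right_eq by (simp_all add: card_image inj_on_Oct card_S_H4)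
  ultimately show ?thesis
    unfolding S_G_def by (simp add: card_Un_disjoint finite_S_H4 S_left_eq S_right_eq)
qed

lemma finite_S_G: "finite S_G"
  unfolding S_G_def S_left_eq S_right_eq by (simp add: finite_S_H4)

lemma span_S_G: "span S_G = UNIV"
proof -
  have "x \<in> span S_G" for x
  proof -
    have "Oct (hpart x) 0 \<in> span S_left" "Oct 0 (lpart x) \<in> span S_right"
      unfolding S_left_eq S_right_eq span_isometry[OF quat_isometry_Oct(1)]
        span_isometry[OF quat_isometry_Oct(2)] by blast+
    then have "Oct (hpart x) 0 + Oct 0 (lpart x) \<in> span S_G"
      unfolding S_G_def span_Un by blast
    then show ?thesis by (simp add: plus_octonion_def)
  qed
  then show ?thesis by blast
qed

lemma root_system_S_G: "root_system UNIV S_G"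
  by (rule root_system_unit_vectors)
    (simp_all add: finite_S_G S_G_norm S_G_uminus span_S_G S_G_refl_root)

lemma S_G_not_crystallographic: "\<not> crystallographic S_G"
proof
  \<comment> \<open>The bond 5 joins these two roots, and \<open>phi\<close> lies strictly between 1
    and 2.\<close>
  let ?\<alpha> = "Oct (simple_root 0) 0" and ?\<beta> = "Oct (simple_root 1) 0"
  assume "crystallographic S_G"
  then have "cartan ?\<beta> ?\<alpha> \<in> \<int>"
    unfolding crystallographic_def by (simp add: S_G_intros simple_root_in_S_H4)
  moreover have "cartan ?\<beta> ?\<alpha> = - phi"
    by (simp add: cartan_isometry[OF quat_isometry_Oct(1)] simple_root_in_S_H4)
      (simp add: simple_root_simps Quat_simps)
  ultimately have "phi \<in> \<int>" by simp
  then obtain n :: int where "phi = of_int n" by (rule Ints_cases)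
  with phi_bounds have "1 < n" "n < 2" by simp_all
  then show False by presburger
qed

section \<open>The icosian double as a free order of rank 8\<close>

lemma icosian_double_iff: "Oct a b \<in> icosian_double \<longleftrightarrow> a \<in> icosians \<and> b \<in> icosians"
  unfolding icosian_double_def by simp

text \<open>The two families of four are disjoint since 0 is no basis icosian. Freeness of the
  double thereby splits into two copies of that of the icosians.\<close>

lemma icosian_double_basis_sum:
  "(\<Sum>x\<in>(\<lambda>a. Oct a 0) ` ico_basis \<union> Oct 0 ` ico_basis. c x *\<^sub>R x) =
     Oct (\<Sum>a\<in>ico_basis. c (Oct a 0) *\<^sub>R a) (\<Sum>b\<in>ico_basis. c (Oct 0 b) *\<^sub>R b)"
proof -
  have Oct_sum: "(\<Sum>a\<in>A. Oct (f a) 0) = Oct (sum f A) 0" "(\<Sum>a\<in>A. Oct 0 (f a)) = Oct 0 (sum f A)"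
    for f and A :: "quat set"
    by (induction A rule: infinite_finite_induct) (simp_all add: octonion_defs)
  have "0 \<notin> ico_basis" by (simp add: ico_simps)
  then have "(\<lambda>a. Oct a 0) ` ico_basis \<inter> Oct 0 ` ico_basis = {}" by fastforce
  then have "(\<Sum>x\<in>(\<lambda>a. Oct a 0) ` ico_basis \<union> Oct 0 ` ico_basis. c x *\<^sub>R x) =
      (\<Sum>a\<in>ico_basis. c (Oct a 0) *\<^sub>R Oct a 0) + (\<Sum>b\<in>ico_basis. c (Oct 0 b) *\<^sub>R Oct 0 b)"
    by (subst sum.union_disjoint) (simp_all only: finite_imageI finite.intros
        sum.reindex[OF inj_on_Oct(1)] sum.reindex[OF inj_on_Oct(2)] o_def)
  also have "\<dots> = Oct (\<Sum>a\<in>ico_basis. c (Oct a 0) *\<^sub>R a) (\<Sum>b\<in>ico_basis. c (Oct 0 b) *\<^sub>R b)"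
    by (simp only: scaleR_octonion_def octonion.sel scaleR_zero_right Oct_sum plus_octonion_def
        add_0_left add_0_right)
  finally show ?thesis .
qed

lemma icosian_double_free: "Zphi_free_of_rank 8 icosian_double"
  unfolding Zphi_free_of_rank_def
proof (intro exI conjI)
  let ?B = "(\<lambda>a. Oct a 0) ` ico_basis \<union> Oct 0 ` ico_basis"
  show "finite ?B" by simp
  have "0 \<notin> ico_basis" by (simp add: ico_simps)
  have "card ico_basis = 4" by (simp add: ico_basis_distinct)
  then have "card ((\<lambda>a. Oct a 0) ` ico_basis) = 4" "card (Oct 0 ` ico_basis) = 4"
    by (simp_all only: card_image[OF inj_on_Oct(1)] card_image[OF inj_on_Oct(2)])
  moreover have "(\<lambda>a. Oct a 0) ` ico_basis \<inter> Oct 0 ` ico_basis = {}"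
    using \<open>0 \<notin> ico_basis\<close> by fastforce
  ultimately show "card ?B = 8" by (subst card_Un_disjoint) simp_all
  show "Zphi_independent ?B"
    unfolding Zphi_independent_def
  proof (intro allI impI, elim conjE)
    fix c assume Z: "\<forall>b\<in>?B. c b \<in> Zphi" and "(\<Sum>b\<in>?B. c b *\<^sub>R b) = 0"
    then have "(\<Sum>a\<in>ico_basis. c (Oct a 0) *\<^sub>R a) = 0" "(\<Sum>b\<in>ico_basis. c (Oct 0 b) *\<^sub>R b) = 0"
      unfolding icosian_double_basis_sum zero_octonion_def octonion.inject by blast+
    then have "\<forall>a\<in>ico_basis. c (Oct a 0) = 0" "\<forall>b\<in>ico_basis. c (Oct 0 b) = 0"
      using ico_basis_independent[unfolded Zphi_independent_def, rule_format, of "\<lambda>a. c (Oct a 0)"]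
        ico_basis_independent[unfolded Zphi_independent_def, rule_format, of "\<lambda>b. c (Oct 0 b)"] Z
      by blast+
    then show "\<forall>b\<in>?B. c b = 0" by blast
  qed
  show "icosian_double = Zphi_span ?B"
  proof
    show "icosian_double \<subseteq> Zphi_span ?B"
    proof
      fix x assume "x \<in> icosian_double"
      then obtain a b where x: "x = Oct a b" "a \<in> icosians" "b \<in> icosians"
        unfolding icosian_double_def by blast
      then obtain c d where "\<forall>e\<in>ico_basis. c e \<in> Zphi" "a = (\<Sum>e\<in>ico_basis. c e *\<^sub>R e)"
        "\<forall>e\<in>ico_basis. d e \<in> Zphi" "b = (\<Sum>e\<in>ico_basis. d e *\<^sub>R e)"
        unfolding icosians_eq Zphi_span_def by blast
      \<comment> \<open>As 0 is no basis icosian, a vanishing \<open>lpart\<close> tells the two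
        families apart, and \<open>f\<close> glues \<open>c\<close> and \<open>d\<close>.\<close>
      moreover define f where "f y = (if lpart y = 0 then c (hpart y) else d (lpart y))" for y
      ultimately have "\<forall>y\<in>?B. f y \<in> Zphi" "x = (\<Sum>y\<in>?B. f y *\<^sub>R y)"
        unfolding icosian_double_basis_sum x(1) using \<open>0 \<notin> ico_basis\<close>
        by (auto intro!: sum.cong)
      then show "x \<in> Zphi_span ?B" using Zphi_span_memI[of ?B f] by blast
    qed
    show "Zphi_span ?B \<subseteq> icosian_double"
    proof
      fix x assume "x \<in> Zphi_span ?B"
      then obtain c where c: "\<forall>y\<in>?B. c y \<in> Zphi" "x = (\<Sum>y\<in>?B. c y *\<^sub>R y)"
        unfolding Zphi_span_def by blast
      have "(\<Sum>a\<in>ico_basis. c (Oct a 0) *\<^sub>R a) \<in> icosians"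
        "(\<Sum>b\<in>ico_basis. c (Oct 0 b) *\<^sub>R b) \<in> icosians"
        unfolding icosians_eq using c(1) by (intro Zphi_span_memI; blast)+
      then show "x \<in> icosian_double"
        unfolding c(2) icosian_double_basis_sum icosian_double_iff by blast
    qed
  qed
qed

lemma icosian_double_order: "Zphi_order icosian_double"
  unfolding Zphi_order_def
proof (intro conjI ballI)
  have zero: "0 \<in> icosians" unfolding icosians_eq by (rule Zphi_span_0)
  show "icosian_double \<subseteq> octonions_K"
    unfolding icosian_double_def octonions_K_def using icosians_subset_quats_K by blast
  show "Zphi_finitely_generated icosian_double"
    using icosian_double_free unfolding Zphi_free_of_rank_def Zphi_finitely_generated_def by blast
  show "1 \<in> icosian_double"
    by (simp add: one_octonion_def icosian_double_iff zero icosians_basis)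
  fix x assume "x \<in> icosian_double"
  then obtain a b where x: "x = Oct a b" "a \<in> icosians" "b \<in> icosians"
    unfolding icosian_double_def by blast
  show "ocnj x \<in> icosian_double"
    using x by (simp add: ocnj_def icosian_double_iff icosians_qcnj icosians_uminus)
  have "otrace x = (2 * q1 a) *\<^sub>R 1"
    unfolding x(1) otrace_def ocnj_def
    by (simp add: plus_octonion_def scaleR_octonion_def one_octonion_def qcnj_trace)
  then show "otrace x \<in> Zphi_scalars"
    unfolding Zphi_scalars_def using icosians_trace[OF x(2)] by blast
  \<comment> \<open>The second component of the product is -ba + ba = 0.\<close>
  have "onorm2 x = (qnorm2 a + qnorm2 b) *\<^sub>R 1"
    unfolding x(1) onorm2_def ocnj_def
    by (simp add: octonion_defs mult_qcnj qcnj_mult_self scaleR_add_left)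
  then show "onorm2 x \<in> Zphi_scalars"
    unfolding Zphi_scalars_def using Zphi_add[OF icosians_norm[OF x(2)] icosians_norm[OF x(3)]] by blast
  fix y assume "y \<in> icosian_double"
  then obtain c d where y: "y = Oct c d" "c \<in> icosians" "d \<in> icosians"
    unfolding icosian_double_def by blast
  show "x + y \<in> icosian_double"
    using x y by (simp add: plus_octonion_def icosian_double_iff icosians_add)
  \<comment> \<open>The doubling formula combines icosians only by products, conjugation, sums and
    differences.\<close>
  show "x * y \<in> icosian_double"
    using x y by (simp add: times_octonion_def icosian_double_iff icosians_add icosians_diff
        icosians_mult icosians_qcnj)
qed

lemma S_G_subset_icosian_double: "S_G \<subseteq> icosian_double"
proof
  have "0 \<in> icosians" unfolding icosians_eq by (rule Zphi_span_0)
  then show "x \<in> icosian_double" if "x \<in> S_G" for x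
    using that S_H4_subset_icosians by (elim S_G_cases) (auto simp: icosian_double_iff)
qed

theorem proposition6p6:
  "Zphi_order icosian_double \<and>
   Zphi_free_of_rank 8 icosian_double \<and>
   S_G \<subseteq> icosian_double \<and>
   finite S_G \<and> card S_G = 240 \<and>
   (\<forall>\<alpha>\<in>S_G. - \<alpha> \<in> S_G) \<and>
   (\<forall>\<alpha>\<in>S_G. \<forall>\<beta>\<in>S_G. refl_root \<alpha> \<beta> \<in> S_G) \<and>
   (\<forall>\<alpha>\<in>S_G. \<forall>\<beta>\<in>S_G. cartan \<beta> \<alpha> \<in> Zphi) \<and>
   root_system UNIV S_G \<and>
   \<not> crystallographic S_G \<and>
   orthogonal_union S_G S_left S_right \<and>
   root_system_H4 {Oct a 0 | a. True} S_left \<and>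
   root_system_H4 {Oct 0 b | b. True} S_right"
proof (intro conjI ballI)
  show "orthogonal_union S_G S_left S_right"
    unfolding orthogonal_union_def S_left_eq S_right_eq
    by (auto simp: S_G_def S_left_eq S_right_eq orthogonal_def inner_left_right)
  have "{Oct a 0 | a. True} = range (\<lambda>a. Oct a 0)" "{Oct 0 b | b. True} = range (Oct 0)" by auto
  then show "root_system_H4 {Oct a 0 | a. True} S_left" "root_system_H4 {Oct 0 b | b. True} S_right"
    unfolding S_left_eq S_right_eq
    by (simp_all only: root_system_H4_isometry quat_isometry_Oct)
qed (simp_all add: icosian_double_order icosian_double_free S_G_subset_icosian_double finite_S_G
    card_S_G S_G_uminus S_G_refl_root S_G_cartan root_system_S_G S_G_not_crystallographic)

end
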